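(* Let $(\mathcal{V},g)$ be a generic lightlike manifold with $\dim\mathcal{V}\ge 4$. Then for every integer $d\ge 1$, $g$ is $(d+2,d)$-subrigid; that is, for every $v\in\mathcal{V}$, every $(d+2)$-isometry $\Psi$ of $g$ at $v$ which has a trivial $d$-jet at $v$ has a trivial $(d+1)$-jet at $v$. In particular, an isometry of $g$ with a trivial $1$-jet at some point has a trivial infinite jet at that point.
   Context: Everything is smooth. A lightlike metric $g$ on a manifold $\mathcal{V}$ is a symmetric $2$-tensor which on each tangent space of $\mathcal{V}$ is a positive semi-definite quadratic form with 1-dimensional kernel. The kernel is a direction field $N\subset T\mathcal{V}$, tangent to a 1-dimensional foliation (the null or characteristic foliation). The lightlike metric $g$ is generic if, for any local non-vanishing vector field $X$ tangent to $N$, the Lie derivative $L_Xg$ is non-degenerate on $T\mathcal{V}/N$ at every point (this condition does not depend on the choice of $X$). For $d\ge1$, a (local) diffeomorphism $\Psi$ of $\mathcal{V}$ with $\Psi(v)=v$ is a $d$-isometry of $g$ at $v$ (is isometric up to order $d$ at $v$) if, in local coordinates, all the partial derivatives up to order $d-1$ of the components of $\Psi^*g-g$ vanish at $v$. An isometry is a (local) diffeomorphism $\Psi$ with $\Psi^*g=g$. $\Psi$ has a trivial $d$-jet at $v$ (respectively, a trivial infinite jet) if it has the same $d$-jet (respectively, the same jets of all orders) at $v$ as the identity. *)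

theory Defs
  imports "HOL-Analysis.Analysis"
begin

section \<open>Smooth functions and iterated partial derivatives\<close>

text \<open>Both notions are used on open sets only.\<close>

primrec Ck_on ::
  "nat \<Rightarrow> 'e set \<Rightarrow> ('e::euclidean_space \<Rightarrow> 'f::real_normed_vector) \<Rightarrow> bool" where
  "Ck_on 0 S f \<longleftrightarrow> continuous_on S f"
| "Ck_on (Suc k) S f \<longleftrightarrow>
     (\<forall>x\<in>S. f differentiable (at x)) \<and>
     (\<forall>v. Ck_on k S (\<lambda>x. frechet_derivative f (at x) v))"

definition smooth_on ::
  "'e set \<Rightarrow> ('e::euclidean_space \<Rightarrow> 'f::real_normed_vector) \<Rightarrow> bool" where
  "smooth_on S f \<longleftrightarrow> (\<forall>k. Ck_on k S f)"

text \<open>A multi-index is a list of basis vectors; its length is the order of the derivative.\<close>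

primrec iter_deriv ::
  "'e list \<Rightarrow> ('e::euclidean_space \<Rightarrow> 'f::real_normed_vector) \<Rightarrow> 'e \<Rightarrow> 'f" where
  "iter_deriv [] f = f"
| "iter_deriv (b # bs) f = (\<lambda>x. frechet_derivative (iter_deriv bs f) (at x) b)"

definition same_derivs_upto ::
  "nat \<Rightarrow> ('e::euclidean_space \<Rightarrow> 'f::real_normed_vector) \<Rightarrow> ('e \<Rightarrow> 'f) \<Rightarrow> 'e \<Rightarrow> bool" where
  "same_derivs_upto k f h x \<longleftrightarrow>
     (\<forall>bs. set bs \<subseteq> Basis \<and> length bs \<le> k \<longrightarrow> iter_deriv bs f x = iter_deriv bs h x)"


section \<open>Smooth manifolds\<close>

text \<open>A manifold is a Hausdorff second countable type together with a smooth atlas covering it;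
  its dimension is the dimension of the model space \<open>'e\<close>.  A chart is a pair of its domain
  and its coordinate map (the values of the latter outside the domain are irrelevant).\<close>

type_synonym ('a, 'e) chart = "'a set \<times> ('a \<Rightarrow> 'e)"

abbreviation cdom :: "('a, 'e) chart \<Rightarrow> 'a set" where "cdom \<equiv> fst"
abbreviation coord :: "('a, 'e) chart \<Rightarrow> 'a \<Rightarrow> 'e" where "coord \<equiv> snd"

definition param :: "('a, 'e) chart \<Rightarrow> 'e \<Rightarrow> 'a" where
  "param c = inv_into (cdom c) (coord c)"

definition is_chart :: "('a::topological_space, 'e::euclidean_space) chart \<Rightarrow> bool" where
  "is_chart c \<longleftrightarrow> open (cdom c) \<and> open (coord c ` cdom c) \<and>
     homeomorphism (cdom c) (coord c ` cdom c) (coord c) (param c)"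

text \<open>The coordinate expression of a map with respect to a source and a target chart.\<close>

definition local_rep ::
  "('a, 'e) chart \<Rightarrow> ('a, 'e) chart \<Rightarrow> ('a \<Rightarrow> 'a) \<Rightarrow> 'e \<Rightarrow> 'e" where
  "local_rep c c' \<Psi> = coord c' \<circ> \<Psi> \<circ> param c"

abbreviation transition :: "('a, 'e) chart \<Rightarrow> ('a, 'e) chart \<Rightarrow> 'e \<Rightarrow> 'e" where
  "transition c c' \<equiv> local_rep c c' id"

definition smooth_manifold ::
  "('a::{t2_space, second_countable_topology}, 'e::euclidean_space) chart set \<Rightarrow> bool" where
  "smooth_manifold A \<longleftrightarrow>
     (\<forall>c\<in>A. is_chart c) \<and> (\<Union>c\<in>A. cdom c) = UNIV \<and>
     (\<forall>c\<in>A. \<forall>c'\<in>A. smooth_on (coord c ` (cdom c \<inter> cdom c')) (transition c c'))"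

definition smooth_map ::
  "('a::topological_space, 'e::euclidean_space) chart set \<Rightarrow> 'a set \<Rightarrow> ('a \<Rightarrow> 'a) \<Rightarrow> bool" where
  "smooth_map A U \<Psi> \<longleftrightarrow> open U \<and> continuous_on U \<Psi> \<and>
     (\<forall>c\<in>A. \<forall>c'\<in>A.
        smooth_on (coord c ` {p \<in> U. p \<in> cdom c \<and> \<Psi> p \<in> cdom c'}) (local_rep c c' \<Psi>))"

text \<open>A (local) diffeomorphism of the manifold: a diffeomorphism from an open set \<open>U\<close> onto an
  open set; \<open>U = UNIV\<close> is allowed.\<close>

definition local_diffeo ::
  "('a::topological_space, 'e::euclidean_space) chart set \<Rightarrow> 'a set \<Rightarrow> ('a \<Rightarrow> 'a) \<Rightarrow> bool" where
  "local_diffeo A U \<Psi> \<longleftrightarrow> inj_on \<Psi> U \<and> smooth_map A U \<Psi> \<and>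
     smooth_map A (\<Psi> ` U) (inv_into U \<Psi>)"

definition trivial_jet ::
  "('a::topological_space, 'e::euclidean_space) chart set \<Rightarrow> nat \<Rightarrow> ('a \<Rightarrow> 'a) \<Rightarrow> 'a \<Rightarrow> bool" where
  "trivial_jet A k \<Psi> v \<longleftrightarrow> \<Psi> v = v \<and>
     (\<forall>c\<in>A. v \<in> cdom c \<longrightarrow>
        same_derivs_upto k (local_rep c c \<Psi>) (\<lambda>x. x) (coord c v))"


section \<open>Lightlike metrics\<close>

text \<open>A covariant 2-tensor field is given by its coordinate expressions in the charts of the
  atlas, related by the tensor transformation law: \<open>g c x u w\<close> is the value of the tensor, at the
  point with coordinates \<open>x\<close> in the chart \<open>c\<close>, on the tangent vectors with components
  \<open>u\<close> and \<open>w\<close> in that chart.\<close>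

type_synonym 'e form_field = "'e \<Rightarrow> 'e \<Rightarrow> 'e \<Rightarrow> real"
type_synonym ('a, 'e) tensor2 = "('a, 'e) chart \<Rightarrow> 'e form_field"

definition pullback ::
  "('e::euclidean_space \<Rightarrow> 'e) \<Rightarrow> 'e form_field \<Rightarrow> 'e form_field" where
  "pullback F G x u w =
     G (F x) (frechet_derivative F (at x) u) (frechet_derivative F (at x) w)"

definition symmetric_2_tensor ::
  "('a::topological_space, 'e::euclidean_space) chart set \<Rightarrow> ('a, 'e) tensor2 \<Rightarrow> bool" where
  "symmetric_2_tensor A g \<longleftrightarrow>
     (\<forall>c\<in>A. \<forall>x \<in> coord c ` cdom c. bilinear (g c x) \<and> (\<forall>u w. g c x u w = g c x w u)) \<and>
     (\<forall>c\<in>A. \<forall>i\<in>Basis. \<forall>j\<in>Basis. smooth_on (coord c ` cdom c) (\<lambda>x. g c x i j)) \<and>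
     (\<forall>c\<in>A. \<forall>c'\<in>A. \<forall>x \<in> coord c ` (cdom c \<inter> cdom c').
        g c x = pullback (transition c c') (g c') x)"

definition null_space :: "('e \<Rightarrow> 'e \<Rightarrow> real) \<Rightarrow> 'e set" where
  "null_space B = {u. \<forall>w. B u w = 0}"

definition lightlike_metric ::
  "('a::topological_space, 'e::euclidean_space) chart set \<Rightarrow> ('a, 'e) tensor2 \<Rightarrow> bool" where
  "lightlike_metric A g \<longleftrightarrow> symmetric_2_tensor A g \<and>
     (\<forall>c\<in>A. \<forall>x \<in> coord c ` cdom c. (\<forall>u. g c x u u \<ge> 0) \<and> dim (null_space (g c x)) = 1)"

text \<open>The Lie derivative in coordinates,
  \<open>(L\<^sub>X G)\<^sub>i\<^sub>j = X\<^sup>k \<partial>\<^sub>k G\<^sub>i\<^sub>j + G\<^sub>k\<^sub>j \<partial>\<^sub>i X\<^sup>k + G\<^sub>i\<^sub>k \<partial>\<^sub>j X\<^sup>k\<close>, contracted with \<open>u\<close> and \<open>w\<close>.\<close>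

definition lie_deriv ::
  "('e::euclidean_space \<Rightarrow> 'e) \<Rightarrow> 'e form_field \<Rightarrow> 'e form_field" where
  "lie_deriv X G x u w =
     frechet_derivative (\<lambda>y. G y u w) (at x) (X x)
     + G x (frechet_derivative X (at x) u) w
     + G x u (frechet_derivative X (at x) w)"

text \<open>Local vector fields may be taken on coordinate domains, and are then given by their
  components.  For \<open>X\<close> tangent to the null directions, \<open>N = null_space (g c x)\<close> is contained in
  the null space of \<open>L\<^sub>X g\<close>; the induced form on the quotient by \<open>N\<close> is non-degenerate iff every
  \<open>u\<close> that is \<open>L\<^sub>X g\<close>-orthogonal to everything has zero class, i.e. lies in \<open>N\<close>.\<close>

definition generic_lightlike ::
  "('a::topological_space, 'e::euclidean_space) chart set \<Rightarrow> ('a, 'e) tensor2 \<Rightarrow> bool" where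
  "generic_lightlike A g \<longleftrightarrow> lightlike_metric A g \<and>
     (\<forall>c\<in>A. \<forall>W X.
        open W \<and> W \<subseteq> coord c ` cdom c \<and> smooth_on W X \<and>
        (\<forall>x\<in>W. X x \<noteq> 0 \<and> X x \<in> null_space (g c x)) \<longrightarrow>
        (\<forall>x\<in>W. \<forall>u. (\<forall>w. lie_deriv X (g c) x u w = 0) \<longrightarrow> u \<in> null_space (g c x)))"


section \<open>Isometries, infinitesimal isometries and subrigidity\<close>

definition isometry ::
  "('a::topological_space, 'e::euclidean_space) chart set \<Rightarrow> ('a, 'e) tensor2 \<Rightarrow>
   'a set \<Rightarrow> ('a \<Rightarrow> 'a) \<Rightarrow> bool" where
  "isometry A g U \<Psi> \<longleftrightarrow> local_diffeo A U \<Psi> \<and>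
     (\<forall>p\<in>U. \<forall>c\<in>A. \<forall>c'\<in>A. p \<in> cdom c \<and> \<Psi> p \<in> cdom c' \<longrightarrow>
        pullback (local_rep c c' \<Psi>) (g c') (coord c p) = g c (coord c p))"

text \<open>Since \<open>\<Psi> v = v\<close>, near \<open>v\<close> a single chart serves for source and target.
  The condition does not depend on the chart.\<close>

definition d_isometry_at ::
  "('a::topological_space, 'e::euclidean_space) chart set \<Rightarrow> ('a, 'e) tensor2 \<Rightarrow>
   nat \<Rightarrow> 'a set \<Rightarrow> ('a \<Rightarrow> 'a) \<Rightarrow> 'a \<Rightarrow> bool" where
  "d_isometry_at A g d U \<Psi> v \<longleftrightarrow> local_diffeo A U \<Psi> \<and> v \<in> U \<and> \<Psi> v = v \<and>
     (\<forall>c\<in>A. v \<in> cdom c \<longrightarrow>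
        (\<forall>i\<in>Basis. \<forall>j\<in>Basis. \<forall>bs. set bs \<subseteq> Basis \<and> length bs \<le> d - 1 \<longrightarrow>
           iter_deriv bs (\<lambda>x. pullback (local_rep c c \<Psi>) (g c) x i j - g c x i j) (coord c v) = 0))"

definition subrigid ::
  "('a::topological_space, 'e::euclidean_space) chart set \<Rightarrow> ('a, 'e) tensor2 \<Rightarrow>
   nat \<Rightarrow> nat \<Rightarrow> bool" where
  "subrigid A g m d \<longleftrightarrow>
     (\<forall>v U \<Psi>. d_isometry_at A g m U \<Psi> v \<and> trivial_jet A d \<Psi> v \<longrightarrow> trivial_jet A (d + 1) \<Psi> v)"

end

(*
  Let V = F - id in a chart around the fixed point x0. If V vanishes to order d + 1, the part of
  F^*G - G which is linear in V is the Lie derivative of G along V, and the quadratic part turns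
  out to be negligible, so L_V G vanishes to order d + 2. Freezing G at x0, the form G0(V, .) has
  a symmetrized gradient vanishing to order d + 1, so the classical symmetric/antisymmetric
  argument for Killing fields gives that G0(V, .) vanishes to order d + 2. Hence V = \<nu> X + Y,
  where X spans the null direction and Y vanishes to order d + 2, and the Killing equation becomes
  "symmetrized gradient of G0(Y, .) + \<nu> L_X G = 0" to order d + 2. The compatibility condition of
  this equation says that the Kulkarni-Nomizu product of the Hessian of \<nu> with L_X G vanishes to
  order d; since L_X G has rank at least 3, the Hessian of \<nu> itself vanishes to order d.
*)
theory Submission
  imports Defs
begin

section \<open>Calculus of smooth functions\<close>

text \<open>Orders are counted by \<open>flat\<close>: index m means that all derivatives of order
  less than m vanish. So a trivial d-jet is \<open>flat (d + 1)\<close> for V, a (d+2)-isometry is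
  \<open>flat (d + 2)\<close> for the defect, and the goal is \<open>flat (d + 2)\<close> for V. The
  obstacle is d = 1. The quadratic part G(DV, DV) has a priori order 2d, which falls short of d + 2
  exactly when d = 1. The Killing argument is therefore run twice: once with one order given away,
  where 2d \<ge> d + 1 suffices and G0(V, .) is obtained; this raises the quadratic part to order 2d
  + 1 \<ge> d + 2, and only then is the full order used. Freezing replaces adapted coordinates and
  connections: exchanging a coefficient for its value at x0 gains one order, precisely the order
  lost by differentiating the field. G0 does not see the null component \<nu>. Information on \<nu>
  sits in \<nu> L_X G and comes out after two further derivatives, which is why the isometry must be
  good to order d + 2. On a quotient of dimension 2 the Kulkarni-Nomizu product has a single
  component, too few to annihilate a Hessian; hence the rank at least 3.\<close>

definition dd :: "'e \<Rightarrow> ('e::euclidean_space \<Rightarrow> 'f::real_normed_vector) \<Rightarrow> 'e \<Rightarrow> 'f" where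
  "dd b f x = frechet_derivative f (at x) b"

lemma iter_deriv_Cons: "iter_deriv (b # bs) f = dd b (iter_deriv bs f)"
  by (simp add: dd_def fun_eq_iff)

lemma Ck_on_Suc:
  "Ck_on (Suc k) S f \<longleftrightarrow> (\<forall>x\<in>S. f differentiable (at x)) \<and> (\<forall>v. Ck_on k S (dd v f))"
  by (simp add: dd_def[abs_def])

declare Ck_on.simps(2) [simp del] iter_deriv.simps(2) [simp del]

text \<open>\<open>frechet_derivative\<close> is a choice among the possible derivatives, and
  \<open>f\<close> and \<open>h\<close> have the same candidates at \<open>x\<close>. The equality
  thus covers points of non-differentiability as well.\<close>

lemma frechet_derivative_cong_open:
  assumes "open W" "x \<in> W" "\<And>y. y \<in> W \<Longrightarrow> f y = h y"
  shows "frechet_derivative f (at x) = frechet_derivative h (at x)"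
proof -
  have "(f has_derivative D) (at x) \<longleftrightarrow> (h has_derivative D) (at x)" for D
    using assms has_derivative_transform_within_open[of f D x UNIV W h]
      has_derivative_transform_within_open[of h D x UNIV W f] by auto
  then show ?thesis by (simp add: frechet_derivative_def)
qed

lemma dd_cong:
  assumes "open W" "x \<in> W" "\<And>y. y \<in> W \<Longrightarrow> f y = h y"
  shows "dd b f x = dd b h x"
  unfolding dd_def using frechet_derivative_cong_open[OF assms] by simp

lemma differentiable_cong_open:
  assumes "open W" "x \<in> W" "\<And>y. y \<in> W \<Longrightarrow> f y = h y" "f differentiable (at x)"
  shows "h differentiable (at x)"
  using assms has_derivative_transform_within_open[of f _ x UNIV W h]
  unfolding differentiable_def by blast

lemma has_derivative_dd:
  "f differentiable (at x) \<Longrightarrow> (f has_derivative (\<lambda>v. dd v f x)) (at x)"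
  unfolding dd_def by (simp flip: frechet_derivative_works)

lemma dd_eqI: "(f has_derivative D) (at x) \<Longrightarrow> dd v f x = D v"
  unfolding dd_def using frechet_derivative_at by force

lemma dd_linear: "f differentiable (at x) \<Longrightarrow> linear (\<lambda>v. dd v f x)"
  unfolding dd_def using linear_frechet_derivative by auto

lemma dd_const [simp]: "dd b (\<lambda>x. c) x = 0"
  by (simp add: dd_def)

lemma dd_ident [simp]: "dd b (\<lambda>x. x) x = b"
  by (simp add: dd_def)

lemma dd_add:
  "\<lbrakk>f differentiable (at x); h differentiable (at x)\<rbrakk>
    \<Longrightarrow> dd b (\<lambda>x. f x + h x) x = dd b f x + dd b h x"
  by (rule dd_eqI) (intro derivative_intros has_derivative_dd)

lemma dd_diff:
  "\<lbrakk>f differentiable (at x); h differentiable (at x)\<rbrakk>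
    \<Longrightarrow> dd b (\<lambda>x. f x - h x) x = dd b f x - dd b h x"
  by (rule dd_eqI) (intro derivative_intros has_derivative_dd)

lemma dd_sum:
  "(\<And>i. i \<in> I \<Longrightarrow> f i differentiable (at x))
    \<Longrightarrow> dd b (\<lambda>x. \<Sum>i\<in>I. f i x) x = (\<Sum>i\<in>I. dd b (f i) x)"
  by (rule dd_eqI) (rule has_derivative_sum, rule has_derivative_dd)

lemma dd_bounded_linear:
  "\<lbrakk>bounded_linear T; f differentiable (at x)\<rbrakk> \<Longrightarrow> dd b (\<lambda>x. T (f x)) x = T (dd b f x)"
  by (rule dd_eqI) (rule bounded_linear.has_derivative, assumption, erule has_derivative_dd)

lemma dd_bilinear:
  "\<lbrakk>bounded_bilinear p; f differentiable (at x); h differentiable (at x)\<rbrakk>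
    \<Longrightarrow> dd b (\<lambda>x. p (f x) (h x)) x = p (f x) (dd b h x) + p (dd b f x) (h x)"
  by (rule dd_eqI, rule bounded_bilinear.FDERIV) (auto intro: has_derivative_dd)

lemma dd_euclidean:
  assumes "f differentiable (at x)"
  shows "dd v f x = (\<Sum>i\<in>Basis. (v \<bullet> i) *\<^sub>R dd i f x)"
proof -
  interpret linear "\<lambda>v. dd v f x" by (rule dd_linear[OF assms])
  have "dd v f x = dd (\<Sum>i\<in>Basis. (v \<bullet> i) *\<^sub>R i) f x" by (simp add: euclidean_representation)
  also have "\<dots> = (\<Sum>i\<in>Basis. (v \<bullet> i) *\<^sub>R dd i f x)" by (simp add: sum scale)
  finally show ?thesis .
qed

lemma dd_compose:
  assumes "f differentiable (at x)" "h differentiable (at (f x))"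
  shows "dd b (\<lambda>x. h (f x)) x = dd (dd b f x) h (f x)"
  by (rule dd_eqI)
    (rule has_derivative_compose[OF has_derivative_dd[OF assms(1)] has_derivative_dd[OF assms(2)]])

section \<open>Closure of the classes C^k under algebraic operations and composition\<close>

lemma Ck_on_cong:
  assumes "open W" "\<And>y. y \<in> W \<Longrightarrow> f y = h y" "Ck_on k W f"
  shows "Ck_on k W h"
  using assms(2,3)
proof (induction k arbitrary: f h)
  case 0
  then show ?case using continuous_on_cong[of W W f h] by simp
next
  case (Suc k)
  have "Ck_on k W (dd v h)" for v
    using Suc.IH[of "dd v f" "dd v h"] Suc.prems dd_cong[OF assms(1) _ Suc.prems(1)]
    by (simp add: Ck_on_Suc)
  moreover have "h differentiable (at x)" if "x \<in> W" for x
    using differentiable_cong_open[OF assms(1) that Suc.prems(1)] Suc.prems(2) that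
    by (simp add: Ck_on_Suc)
  ultimately show ?case by (simp add: Ck_on_Suc)
qed

lemma Ck_on_subset: "Ck_on k W f \<Longrightarrow> V \<subseteq> W \<Longrightarrow> Ck_on k V f"
  by (induction k arbitrary: f) (auto simp: Ck_on_Suc intro: continuous_on_subset)

lemma Ck_on_SucD: "Ck_on (Suc k) W f \<Longrightarrow> Ck_on k W f"
proof (induction k arbitrary: f)
  case 0
  then show ?case
    by (auto simp: Ck_on_Suc intro!: differentiable_imp_continuous_on)
       (meson differentiable_at_withinI differentiable_on_def)
next
  case (Suc k)
  then have "\<forall>x\<in>W. f differentiable (at x)" "\<And>v. Ck_on (Suc k) W (dd v f)"
    unfolding Ck_on_Suc[of "Suc k"] by auto
  with Suc.IH show ?case unfolding Ck_on_Suc[of k W f] by blast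
qed

lemma Ck_on_mono: "Ck_on k W f \<Longrightarrow> j \<le> k \<Longrightarrow> Ck_on j W f"
  by (induction k) (auto dest: Ck_on_SucD simp: le_Suc_eq)

lemma Ck_on_continuous_on: "Ck_on k W f \<Longrightarrow> continuous_on W f"
  using Ck_on_mono[of k W f 0] by simp

lemma Ck_on_const: "Ck_on k W (\<lambda>x. c)"
proof (induction k arbitrary: c)
  case (Suc k)
  have "dd v (\<lambda>x::'a. c) = (\<lambda>x. 0)" for v by auto
  with Suc show ?case by (simp add: Ck_on_Suc)
qed simp

lemma Ck_on_ident: "Ck_on k W (\<lambda>x. x)"
proof (cases k)
  case (Suc j)
  have "dd v (\<lambda>x::'a. x) = (\<lambda>x. v)" for v by auto
  with Suc show ?thesis by (simp add: Ck_on_Suc Ck_on_const)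
qed simp

lemma Ck_on_add:
  assumes "open W" "Ck_on k W f" "Ck_on k W h"
  shows "Ck_on k W (\<lambda>x. f x + h x)"
  using assms(2,3)
proof (induction k arbitrary: f h)
  case 0
  then show ?case by (simp add: continuous_on_add)
next
  case (Suc k)
  have "Ck_on k W (dd v (\<lambda>x. f x + h x))" for v
  proof (rule Ck_on_cong[OF assms(1)])
    show "Ck_on k W (\<lambda>x. dd v f x + dd v h x)"
      using Suc.prems by (intro Suc.IH) (simp_all add: Ck_on_Suc)
  qed (use Suc.prems in \<open>simp add: Ck_on_Suc dd_add\<close>)
  with Suc.prems show ?case by (simp add: Ck_on_Suc)
qed

lemma Ck_on_bounded_linear:
  assumes "open W" "bounded_linear T" "Ck_on k W f"
  shows "Ck_on k W (\<lambda>x. T (f x))"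
  using assms(3)
proof (induction k arbitrary: f)
  case 0
  then show ?case using assms(2) by (simp add: bounded_linear.continuous_on)
next
  case (Suc k)
  have "Ck_on k W (dd v (\<lambda>x. T (f x)))" for v
  proof (rule Ck_on_cong[OF assms(1)])
    show "Ck_on k W (\<lambda>x. T (dd v f x))"
      using Suc.prems by (intro Suc.IH) (simp_all add: Ck_on_Suc)
  qed (use Suc.prems in \<open>simp add: Ck_on_Suc dd_bounded_linear[OF assms(2)]\<close>)
  moreover have "(\<lambda>x. T (f x)) differentiable (at x)" if "x \<in> W" for x
    using Suc.prems that bounded_linear.has_derivative[OF assms(2)]
    unfolding Ck_on_Suc differentiable_def by blast
  ultimately show ?case by (auto simp: Ck_on_Suc)
qed

lemma Ck_on_bilinear:
  assumes "open W" "bounded_bilinear p" "Ck_on k W f" "Ck_on k W h"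
  shows "Ck_on k W (\<lambda>x. p (f x) (h x))"
  using assms(3,4)
proof (induction k arbitrary: f h)
  case 0
  then show ?case using assms(2) by (simp add: bounded_bilinear.continuous_on)
next
  case (Suc k)
  have "Ck_on k W (dd v (\<lambda>x. p (f x) (h x)))" for v
  proof (rule Ck_on_cong[OF assms(1)])
    show "Ck_on k W (\<lambda>x. p (f x) (dd v h x) + p (dd v f x) (h x))"
      using Suc.prems Ck_on_SucD[OF Suc.prems(1)] Ck_on_SucD[OF Suc.prems(2)]
      by (intro Ck_on_add[OF assms(1)] Suc.IH) (auto simp: Ck_on_Suc)
  qed (use Suc.prems in \<open>auto simp: Ck_on_Suc dd_bilinear[OF assms(2)]\<close>)
  moreover have "(\<lambda>x. p (f x) (h x)) differentiable (at x)" if "x \<in> W" for x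
    using Suc.prems that bounded_bilinear.FDERIV[OF assms(2)]
    unfolding Ck_on_Suc differentiable_def by blast
  ultimately show ?case by (auto simp: Ck_on_Suc)
qed

lemma Ck_on_sum:
  assumes "open W" "\<And>i. i \<in> I \<Longrightarrow> Ck_on k W (f i)"
  shows "Ck_on k W (\<lambda>x. \<Sum>i\<in>I. f i x)"
  using assms(2)
  by (induction I rule: infinite_finite_induct) (auto simp: Ck_on_const Ck_on_add[OF assms(1)])

lemma Ck_on_compose:
  fixes f :: "'d::euclidean_space \<Rightarrow> 'e::euclidean_space" and h :: "'e \<Rightarrow> 'f::real_normed_vector"
  assumes "open W" "Ck_on k W f" "Ck_on k V h" "f ` W \<subseteq> V"
  shows "Ck_on k W (\<lambda>x. h (f x))"
  using assms(2,3)
proof (induction k arbitrary: h)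
  case 0
  then show ?case using assms(4) by (auto intro: continuous_on_compose2)
next
  case (Suc k)
  have hd: "h differentiable (at (f x))" if "x \<in> W" for x
    using Suc.prems assms(4) that by (auto simp: Ck_on_Suc)
  have "Ck_on k W (dd v (\<lambda>x. h (f x)))" for v
  proof (rule Ck_on_cong[OF assms(1)])
    \<comment> \<open>Expanding the direction \<open>dd v f x\<close> in the basis moves its
      dependence on \<open>x\<close> into scalar coefficients. What remains are derivatives of
      \<open>h\<close> in fixed directions, to which the induction hypothesis applies.\<close>
    show "Ck_on k W (\<lambda>x. \<Sum>i\<in>Basis. (dd v f x \<bullet> i) *\<^sub>R dd i h (f x))"
    proof (intro Ck_on_sum[OF assms(1)] Ck_on_bilinear[OF assms(1) bounded_bilinear_scaleR])
      fix i :: 'e assume "i \<in> Basis"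
      show "Ck_on k W (\<lambda>x. dd v f x \<bullet> i)"
        by (rule Ck_on_bounded_linear[OF assms(1) bounded_linear_inner_left])
          (use Suc.prems in \<open>auto simp: Ck_on_Suc\<close>)
      show "Ck_on k W (\<lambda>x. dd i h (f x))"
        using Suc.prems Ck_on_SucD[OF Suc.prems(1)] by (intro Suc.IH) (auto simp: Ck_on_Suc)
    qed
    show "(\<Sum>i\<in>Basis. (dd v f x \<bullet> i) *\<^sub>R dd i h (f x)) = dd v (\<lambda>x. h (f x)) x" if "x \<in> W" for x
      using Suc.prems that hd[OF that]
      by (simp add: dd_compose Ck_on_Suc flip: dd_euclidean)
  qed
  moreover have "(\<lambda>x. h (f x)) differentiable (at x)" if "x \<in> W" for x
    using Suc.prems that hd[OF that] differentiable_chain_at[of f x h]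
    by (auto simp: Ck_on_Suc o_def)
  ultimately show ?case by (auto simp: Ck_on_Suc)
qed

lemma smooth_on_cong:
  "\<lbrakk>open W; \<And>y. y \<in> W \<Longrightarrow> f y = h y; smooth_on W f\<rbrakk> \<Longrightarrow> smooth_on W h"
  unfolding smooth_on_def using Ck_on_cong by blast

lemma smooth_on_subset: "smooth_on W f \<Longrightarrow> V \<subseteq> W \<Longrightarrow> smooth_on V f"
  unfolding smooth_on_def using Ck_on_subset by blast

lemma smooth_on_differentiable: "smooth_on W f \<Longrightarrow> x \<in> W \<Longrightarrow> f differentiable (at x)"
  unfolding smooth_on_def using Ck_on_Suc by blast

lemma smooth_on_continuous_on: "smooth_on W f \<Longrightarrow> continuous_on W f"
  unfolding smooth_on_def using Ck_on_continuous_on by blast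

lemma smooth_on_dd: "smooth_on W f \<Longrightarrow> smooth_on W (dd b f)"
  unfolding smooth_on_def using Ck_on_Suc by blast

lemma smooth_on_iter_deriv: "smooth_on W f \<Longrightarrow> smooth_on W (iter_deriv bs f)"
  by (induction bs) (auto simp: iter_deriv_Cons smooth_on_dd)

lemma smooth_on_const: "smooth_on W (\<lambda>x. c)"
  by (simp add: smooth_on_def Ck_on_const)

lemma smooth_on_ident: "smooth_on W (\<lambda>x. x)"
  by (simp add: smooth_on_def Ck_on_ident)

lemma smooth_on_add: "\<lbrakk>open W; smooth_on W f; smooth_on W h\<rbrakk> \<Longrightarrow> smooth_on W (\<lambda>x. f x + h x)"
  by (simp add: smooth_on_def Ck_on_add)

lemma smooth_on_bounded_linear:
  "\<lbrakk>open W; bounded_linear T; smooth_on W f\<rbrakk> \<Longrightarrow> smooth_on W (\<lambda>x. T (f x))"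
  by (simp add: smooth_on_def Ck_on_bounded_linear)

lemma smooth_on_inner: "\<lbrakk>open W; smooth_on W f\<rbrakk> \<Longrightarrow> smooth_on W (\<lambda>x. f x \<bullet> a)"
  by (rule smooth_on_bounded_linear[OF _ bounded_linear_inner_left])

lemma smooth_on_diff: "\<lbrakk>open W; smooth_on W f; smooth_on W h\<rbrakk> \<Longrightarrow> smooth_on W (\<lambda>x. f x - h x)"
  using smooth_on_add[of W f "\<lambda>x. - h x"]
    smooth_on_bounded_linear[OF _ bounded_linear_minus[OF bounded_linear_ident], of W h]
  by simp

lemma smooth_on_mult:
  fixes f h :: "'e::euclidean_space \<Rightarrow> real"
  shows "\<lbrakk>open W; smooth_on W f; smooth_on W h\<rbrakk> \<Longrightarrow> smooth_on W (\<lambda>x. f x * h x)"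
  by (simp add: smooth_on_def Ck_on_bilinear[OF _ bounded_bilinear_mult])

lemma smooth_on_scaleR:
  "\<lbrakk>open W; smooth_on W f; smooth_on W h\<rbrakk> \<Longrightarrow> smooth_on W (\<lambda>x. f x *\<^sub>R h x)"
  by (simp add: smooth_on_def Ck_on_bilinear[OF _ bounded_bilinear_scaleR])

lemma smooth_on_sum:
  "\<lbrakk>open W; \<And>i. i \<in> I \<Longrightarrow> smooth_on W (f i)\<rbrakk> \<Longrightarrow> smooth_on W (\<lambda>x. \<Sum>i\<in>I. f i x)"
  by (simp add: smooth_on_def Ck_on_sum)

lemma smooth_on_compose:
  fixes f :: "'d::euclidean_space \<Rightarrow> 'e::euclidean_space" and h :: "'e \<Rightarrow> 'f::real_normed_vector"
  shows "\<lbrakk>open W; smooth_on W f; smooth_on V h; f ` W \<subseteq> V\<rbrakk> \<Longrightarrow> smooth_on W (\<lambda>x. h (f x))"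
  unfolding smooth_on_def using Ck_on_compose by blast

text \<open>Two applications of the mean value theorem, along \<open>a\<close> and then along
  \<open>b\<close>. The left side is symmetric in \<open>a\<close> and \<open>b\<close>, the right
  side is not; that contrast gives the symmetry of second derivatives.\<close>

lemma second_difference_mvt:
  fixes f :: "'e::euclidean_space \<Rightarrow> real"
  assumes sm: "smooth_on W f" and "ball x r \<subseteq> W" "t > 0" "t * (norm a + norm b) < r"
  shows "\<exists>p\<in>ball x r. f (x + t *\<^sub>R a + t *\<^sub>R b) - f (x + t *\<^sub>R a) - f (x + t *\<^sub>R b) + f x
    = t * (t * dd b (dd a f) p)"
proof -
  have inb: "x + s *\<^sub>R a + s' *\<^sub>R b \<in> ball x r" if "0 \<le> s" "s \<le> t" "0 \<le> s'" "s' \<le> t" for s s'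
  proof -
    have "norm (s *\<^sub>R a + s' *\<^sub>R b) \<le> s * norm a + s' * norm b"
      using norm_triangle_ineq[of "s *\<^sub>R a" "s' *\<^sub>R b"] that by simp
    also have "\<dots> \<le> t * norm a + t * norm b"
      using that by (intro add_mono mult_right_mono) auto
    finally have "norm (s *\<^sub>R a + s' *\<^sub>R b) < r" using assms(4) by (simp add: distrib_left)
    moreover have "dist x (x + s *\<^sub>R a + s' *\<^sub>R b) = norm (s *\<^sub>R a + s' *\<^sub>R b)"
      using norm_minus_cancel[of "s *\<^sub>R a + s' *\<^sub>R b"] by (simp add: dist_norm algebra_simps)
    ultimately show ?thesis by simp
  qed
  have der: "((\<lambda>s. h (y + s *\<^sub>R c)) has_real_derivative dd c h (y + s *\<^sub>R c)) (at s)"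
    if "smooth_on W h" "y + s *\<^sub>R c \<in> W" for h :: "'e \<Rightarrow> real" and y c s
  proof -
    have hd: "h differentiable (at (y + s *\<^sub>R c))" using that smooth_on_differentiable by blast
    have "((\<lambda>s. y + s *\<^sub>R c) has_derivative (\<lambda>s. s *\<^sub>R c)) (at s)"
      by (auto intro!: derivative_eq_intros)
    from has_derivative_compose[OF this has_derivative_dd[OF hd]]
    have "((\<lambda>s. h (y + s *\<^sub>R c)) has_derivative (\<lambda>u. dd (u *\<^sub>R c) h (y + s *\<^sub>R c))) (at s)" .
    moreover have "dd (u *\<^sub>R c) h (y + s *\<^sub>R c) = dd c h (y + s *\<^sub>R c) * u" for u
      using linear_scale[OF dd_linear[OF hd], of u c] by simp
    ultimately show ?thesis by (simp add: has_field_derivative_def)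
  qed
  \<comment> \<open>The increment in direction \<open>b\<close>, moved along \<open>a\<close>: the
    second difference is the increment of this function between 0 and \<open>t\<close>.\<close>
  define \<phi> where "\<phi> s = f (x + t *\<^sub>R b + s *\<^sub>R a) - f (x + s *\<^sub>R a)" for s
  have "DERIV \<phi> s :> dd a f (x + t *\<^sub>R b + s *\<^sub>R a) - dd a f (x + s *\<^sub>R a)"
    if "0 \<le> s" "s \<le> t" for s
    unfolding \<phi>_def
    using inb[of s t] inb[of s 0] that assms(2,3)
    by (intro derivative_intros der[OF sm]) (auto simp: algebra_simps)
  from MVT2[OF \<open>t > 0\<close> this] obtain \<xi> where \<xi>: "0 < \<xi>" "\<xi> < t"
    and 1: "\<phi> t - \<phi> 0 = t * (dd a f (x + t *\<^sub>R b + \<xi> *\<^sub>R a) - dd a f (x + \<xi> *\<^sub>R a))" by auto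
  have "DERIV (\<lambda>s. dd a f (x + \<xi> *\<^sub>R a + s *\<^sub>R b)) s :> dd b (dd a f) (x + \<xi> *\<^sub>R a + s *\<^sub>R b)"
    if "0 \<le> s" "s \<le> t" for s
    using inb[of \<xi> s] that assms(2) \<xi>
    by (intro der[OF smooth_on_dd[OF sm]]) auto
  from MVT2[OF \<open>t > 0\<close> this] obtain \<eta> where \<eta>: "0 < \<eta>" "\<eta> < t"
    and 2: "dd a f (x + \<xi> *\<^sub>R a + t *\<^sub>R b) - dd a f (x + \<xi> *\<^sub>R a)
      = t * dd b (dd a f) (x + \<xi> *\<^sub>R a + \<eta> *\<^sub>R b)" by auto
  have "f (x + t *\<^sub>R a + t *\<^sub>R b) - f (x + t *\<^sub>R a) - f (x + t *\<^sub>R b) + f x = \<phi> t - \<phi> 0"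
    by (simp add: \<phi>_def algebra_simps)
  also have "\<dots> = t * (t * dd b (dd a f) (x + \<xi> *\<^sub>R a + \<eta> *\<^sub>R b))"
    using 1 2 by (simp add: algebra_simps)
  finally show ?thesis using inb[of \<xi> \<eta>] \<xi> \<eta> by force
qed

text \<open>Both mixed derivatives attain, at points close to \<open>x\<close>, the same value: the
  common second difference divided by the square of \<open>t\<close>. Were they different at
  \<open>x\<close>, continuity with half of the gap as tolerance would exclude this.\<close>

lemma dd_commute:
  fixes f :: "'e::euclidean_space \<Rightarrow> real"
  assumes "open W" "smooth_on W f" "x \<in> W"
  shows "dd a (dd b f) x = dd b (dd a f) x"
proof (rule ccontr)
  assume ne: "dd a (dd b f) x \<noteq> dd b (dd a f) x"
  define \<epsilon> where "\<epsilon> = \<bar>dd a (dd b f) x - dd b (dd a f) x\<bar> / 2"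
  have "\<epsilon> > 0" using ne by (simp add: \<epsilon>_def)
  have cont: "\<exists>r>0. \<forall>y\<in>ball x r. \<bar>dd c (dd e f) y - dd c (dd e f) x\<bar> < \<epsilon>" for c e
  proof -
    have "continuous_on W (dd c (dd e f))"
      by (intro smooth_on_continuous_on smooth_on_dd assms)
    then have "continuous (at x) (dd c (dd e f))"
      using assms continuous_on_eq_continuous_at by blast
    with \<open>\<epsilon> > 0\<close> show ?thesis
      by (auto simp: continuous_at_eps_delta dist_real_def dist_commute ball_def)
  qed
  obtain r1 where r1: "r1 > 0" "ball x r1 \<subseteq> W" using assms openE by blast
  obtain r2 where r2: "r2 > 0" "\<forall>y\<in>ball x r2. \<bar>dd a (dd b f) y - dd a (dd b f) x\<bar> < \<epsilon>"
    using cont by blast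
  obtain r3 where r3: "r3 > 0" "\<forall>y\<in>ball x r3. \<bar>dd b (dd a f) y - dd b (dd a f) x\<bar> < \<epsilon>"
    using cont by blast
  define r where "r = min r1 (min r2 r3)"
  have r: "r > 0" "ball x r \<subseteq> W" using r1 r2 r3 by (auto simp: r_def)
  \<comment> \<open>The summand 1 keeps the denominator positive when \<open>a\<close> and
    \<open>b\<close> vanish, and makes the bound by \<open>r\<close> strict.\<close>
  define t where "t = r / (norm a + norm b + 1)"
  have pos: "norm a + norm b + 1 > 0" by (smt (verit) norm_ge_zero)
  have t: "t > 0" "t * (norm a + norm b) < r" using r pos by (auto simp: t_def field_simps)
  obtain p where p: "p \<in> ball x r" "f (x + t *\<^sub>R a + t *\<^sub>R b) - f (x + t *\<^sub>R a) - f (x + t *\<^sub>R b) + f x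
    = t * (t * dd b (dd a f) p)"
    using second_difference_mvt[OF assms(2) r(2) t] by auto
  obtain q where q: "q \<in> ball x r" "f (x + t *\<^sub>R b + t *\<^sub>R a) - f (x + t *\<^sub>R b) - f (x + t *\<^sub>R a) + f x
    = t * (t * dd a (dd b f) q)"
    using second_difference_mvt[OF assms(2) r(2) t(1), of b a] t(2) by (auto simp: add.commute)
  have "t * (t * dd b (dd a f) p) = t * (t * dd a (dd b f) q)"
    using p(2) q(2) by (simp add: algebra_simps)
  then have "dd b (dd a f) p = dd a (dd b f) q" using t by simp
  moreover have "\<bar>dd b (dd a f) p - dd b (dd a f) x\<bar> < \<epsilon>" using p r3 by (auto simp: r_def)
  moreover have "\<bar>dd a (dd b f) q - dd a (dd b f) x\<bar> < \<epsilon>" using q r2 by (auto simp: r_def)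
  ultimately show False by (simp add: \<epsilon>_def abs_if split: if_splits)
qed

section \<open>Functions vanishing to a given order\<close>

text \<open>The ideal of functions all of whose derivatives of order less than \<open>k\<close> vanish at \<open>x\<close>,
  that is, the \<open>k\<close>-th power of the ideal of functions vanishing at \<open>x\<close>.\<close>

definition flat :: "nat \<Rightarrow> ('e::euclidean_space \<Rightarrow> 'f::real_normed_vector) \<Rightarrow> 'e \<Rightarrow> bool" where
  "flat k f x \<longleftrightarrow> (\<forall>bs. set bs \<subseteq> Basis \<and> length bs < k \<longrightarrow> iter_deriv bs f x = 0)"

lemma iter_deriv_snoc: "iter_deriv (bs @ [b]) f = iter_deriv bs (dd b f)"
  by (induction bs) (simp_all add: iter_deriv_Cons)

lemma iter_deriv_cong:
  assumes "open W" "x \<in> W" "\<And>y. y \<in> W \<Longrightarrow> f y = h y"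
  shows "iter_deriv bs f x = iter_deriv bs h x"
  using assms(2)
proof (induction bs arbitrary: x)
  case (Cons b bs)
  then show ?case using dd_cong[OF assms(1)] by (metis iter_deriv_Cons)
qed (use assms in auto)

lemma iter_deriv_add:
  assumes "open W" "smooth_on W f" "smooth_on W h" "x \<in> W"
  shows "iter_deriv bs (\<lambda>x. f x + h x) x = iter_deriv bs f x + iter_deriv bs h x"
  using assms(4)
proof (induction bs arbitrary: x)
  case (Cons b bs)
  have "iter_deriv (b # bs) (\<lambda>x. f x + h x) x = dd b (\<lambda>x. iter_deriv bs f x + iter_deriv bs h x) x"
    unfolding iter_deriv_Cons using Cons by (intro dd_cong[OF assms(1)]) auto
  also have "\<dots> = iter_deriv (b # bs) f x + iter_deriv (b # bs) h x"
    unfolding iter_deriv_Cons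
    using assms Cons.prems by (intro dd_add smooth_on_differentiable[OF smooth_on_iter_deriv])
  finally show ?case .
qed simp

lemma iter_deriv_bounded_linear:
  assumes "open W" "bounded_linear T" "smooth_on W f" "x \<in> W"
  shows "iter_deriv bs (\<lambda>x. T (f x)) x = T (iter_deriv bs f x)"
  using assms(4)
proof (induction bs arbitrary: x)
  case (Cons b bs)
  have "iter_deriv (b # bs) (\<lambda>x. T (f x)) x = dd b (\<lambda>x. T (iter_deriv bs f x)) x"
    unfolding iter_deriv_Cons using Cons by (intro dd_cong[OF assms(1)]) auto
  also have "\<dots> = T (iter_deriv (b # bs) f x)"
    unfolding iter_deriv_Cons using assms Cons.prems
    by (intro dd_bounded_linear smooth_on_differentiable[OF smooth_on_iter_deriv])
  finally show ?case .
qed simp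

lemma iter_deriv_minus:
  assumes "open W" "smooth_on W f" "x \<in> W"
  shows "iter_deriv bs (\<lambda>x. - f x) x = - iter_deriv bs f x"
  using iter_deriv_bounded_linear[OF assms(1) bounded_linear_minus[OF bounded_linear_ident] assms(2,3)] .

lemma iter_deriv_diff:
  assumes "open W" "smooth_on W f" "smooth_on W h" "x \<in> W"
  shows "iter_deriv bs (\<lambda>x. f x - h x) x = iter_deriv bs f x - iter_deriv bs h x"
proof -
  have "smooth_on W (\<lambda>x. - h x)"
    using smooth_on_bounded_linear[OF assms(1) bounded_linear_minus[OF bounded_linear_ident] assms(3)] .
  from iter_deriv_add[OF assms(1,2) this assms(4)] show ?thesis
    by (simp add: iter_deriv_minus[OF assms(1,3,4)])
qed

lemma iter_deriv_zero: "iter_deriv bs (\<lambda>x. 0) = (\<lambda>x. 0)"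
  by (induction bs) (auto simp: iter_deriv_Cons)

lemma flat_0 [simp]: "flat 0 f x"
  by (simp add: flat_def)

text \<open>The list is split at its end: \<open>iter_deriv\<close> applies the last direction
  first, so what is left is an iterated derivative of \<open>dd b f\<close>. This turns
  \<open>flat\<close> into a recursion suited to inductions on the order.\<close>

lemma flat_Suc: "flat (Suc k) f x \<longleftrightarrow> f x = 0 \<and> (\<forall>b\<in>Basis. flat k (dd b f) x)"
proof (intro iffI conjI ballI)
  assume *: "flat (Suc k) f x"
  show "f x = 0" using *[unfolded flat_def, rule_format, of "[]"] by simp
  show "flat k (dd b f) x" if "b \<in> Basis" for b
    unfolding flat_def
  proof safe
    fix bs assume "set bs \<subseteq> (Basis :: 'a set)" "length bs < k"
    then show "iter_deriv bs (dd b f) x = 0"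
      using *[unfolded flat_def, rule_format, of "bs @ [b]"] that by (simp add: iter_deriv_snoc)
  qed
next
  assume *: "f x = 0 \<and> (\<forall>b\<in>Basis. flat k (dd b f) x)"
  show "flat (Suc k) f x"
    unfolding flat_def
  proof safe
    fix bs assume "set bs \<subseteq> (Basis :: 'a set)" "length bs < Suc k"
    then show "iter_deriv bs f x = 0"
    proof (cases bs rule: rev_cases)
      case (snoc cs c)
      with * \<open>set bs \<subseteq> Basis\<close> \<open>length bs < Suc k\<close> show ?thesis
        by (simp add: iter_deriv_snoc flat_def)
    qed (use * in simp)
  qed
qed

lemma flat_mono: "flat k f x \<Longrightarrow> j \<le> k \<Longrightarrow> flat j f x"
  by (auto simp: flat_def)

lemma flat_cong:
  assumes "open W" "x \<in> W" "\<And>y. y \<in> W \<Longrightarrow> f y = h y" "flat k f x"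
  shows "flat k h x"
  using assms(4) iter_deriv_cong[OF assms(1-3)] by (simp add: flat_def)

lemma flat_zero: "flat k (\<lambda>x. 0) x"
  by (simp add: flat_def iter_deriv_zero)

lemma flat_add:
  assumes "open W" "x \<in> W" "smooth_on W f" "smooth_on W h" "flat k f x" "flat k h x"
  shows "flat k (\<lambda>x. f x + h x) x"
  using assms by (simp add: flat_def iter_deriv_add[OF assms(1,3,4,2)])

lemma flat_diff:
  assumes "open W" "x \<in> W" "smooth_on W f" "smooth_on W h" "flat k f x" "flat k h x"
  shows "flat k (\<lambda>x. f x - h x) x"
  using assms by (simp add: flat_def iter_deriv_diff[OF assms(1,3,4,2)])

lemma flat_bounded_linear:
  assumes "open W" "x \<in> W" "bounded_linear T" "smooth_on W f" "flat k f x"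
  shows "flat k (\<lambda>x. T (f x)) x"
  using assms linear_0[OF bounded_linear.linear[OF assms(3)]]
  by (simp add: flat_def iter_deriv_bounded_linear[OF assms(1,3,4,2)])

lemma flat_inner:
  "\<lbrakk>open W; x \<in> W; smooth_on W f; flat k f x\<rbrakk> \<Longrightarrow> flat k (\<lambda>x. f x \<bullet> a) x"
  by (rule flat_bounded_linear[OF _ _ bounded_linear_inner_left])

lemma flat_sum:
  assumes "open W" "x \<in> W" "\<And>i. i \<in> I \<Longrightarrow> smooth_on W (f i)" "\<And>i. i \<in> I \<Longrightarrow> flat k (f i) x"
  shows "flat k (\<lambda>x. \<Sum>i\<in>I. f i x) x"
  using assms(3,4)
proof (induction I rule: infinite_finite_induct)
  case (insert i I)
  then show ?case
    using flat_add[OF assms(1,2), of "f i" "\<lambda>x. \<Sum>i\<in>I. f i x" k] smooth_on_sum[OF assms(1), of I f]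
    by simp
qed (auto simp: flat_zero)

lemma flat_dd:
  assumes "open W" "x \<in> W" "smooth_on W f" "flat (Suc k) f x"
  shows "flat k (dd v f) x"
proof (rule flat_cong[OF assms(1,2)])
  show "flat k (\<lambda>x. \<Sum>i\<in>Basis. (v \<bullet> i) *\<^sub>R dd i f x) x"
  proof (rule flat_sum[OF assms(1,2)])
    fix i :: 'a assume "i \<in> Basis"
    then have "flat k (dd i f) x" using assms(4) by (simp add: flat_Suc)
    then show "flat k (\<lambda>x. (v \<bullet> i) *\<^sub>R dd i f x) x"
      by (rule flat_bounded_linear[OF assms(1,2) bounded_linear_scaleR_right smooth_on_dd[OF assms(3)]])
    show "smooth_on W (\<lambda>x. (v \<bullet> i) *\<^sub>R dd i f x)"
      by (rule smooth_on_bounded_linear[OF assms(1) bounded_linear_scaleR_right smooth_on_dd[OF assms(3)]])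
  qed
  show "(\<Sum>i\<in>Basis. (v \<bullet> i) *\<^sub>R dd i f y) = dd v f y" if "y \<in> W" for y
    by (rule dd_euclidean[OF smooth_on_differentiable[OF assms(3) that], symmetric])
qed

lemma flat_scaleR:
  assumes "open W" "x \<in> W" "smooth_on W f" "smooth_on W h" "flat k f x" "flat l h x" "n \<le> k + l"
  shows "flat n (\<lambda>x. f x *\<^sub>R h x) x"
  using assms(3-)
proof (induction n arbitrary: k l f h)
  case (Suc n)
  have "f x *\<^sub>R h x = 0"
    using Suc.prems by (cases k; cases l) (auto simp: flat_Suc)
  moreover have "flat n (dd b (\<lambda>x. f x *\<^sub>R h x)) x" if "b \<in> Basis" for b
  proof (rule flat_cong[OF assms(1,2)])
    \<comment> \<open>Truncated subtraction does no harm: if \<open>k = 0\<close>, then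
      \<open>Suc n \<le> l\<close> already gives the order needed for the second product below, and
      likewise with \<open>l = 0\<close> for the first.\<close>
    have "flat (k - 1) (dd b f) x" "flat (l - 1) (dd b h) x"
      using Suc.prems that by (cases k; cases l; simp add: flat_Suc)+
    then show "flat n (\<lambda>x. f x *\<^sub>R dd b h x + dd b f x *\<^sub>R h x) x"
      using Suc.prems
      by (intro flat_add[OF assms(1,2)] smooth_on_scaleR[OF assms(1)] smooth_on_dd
          Suc.IH[of f "dd b h" k "l - 1"] Suc.IH[of "dd b f" h "k - 1" l]) auto
    show "f y *\<^sub>R dd b h y + dd b f y *\<^sub>R h y = dd b (\<lambda>x. f x *\<^sub>R h x) y" if "y \<in> W" for y
      using dd_bilinear[OF bounded_bilinear_scaleR] Suc.prems smooth_on_differentiable that by metis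
  qed
  ultimately show ?case by (simp add: flat_Suc)
qed simp

lemma flat_mult:
  fixes f h :: "'e::euclidean_space \<Rightarrow> real"
  assumes "open W" "x \<in> W" "smooth_on W f" "smooth_on W h" "flat k f x" "flat l h x" "n \<le> k + l"
  shows "flat n (\<lambda>x. f x * h x) x"
  using flat_scaleR[OF assms] by simp

text \<open>Both Killing arguments control second derivatives only; the value and the gradient at
  \<open>x\<close> have to be supplied by \<open>flat 2\<close>.\<close>

lemma flat_of_dd2:
  assumes "flat 2 f x" "\<And>a b. flat k (dd a (dd b f)) x"
  shows "flat (k + 2) f x"
  using assms by (simp add: flat_Suc numeral_2_eq_2)

section \<open>Forms with vanishing Kulkarni-Nomizu product\<close>

lemma linear_euclidean:
  fixes f :: "'e::euclidean_space \<Rightarrow> real"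
  assumes "linear f"
  shows "f w = (\<Sum>i\<in>Basis. (w \<bullet> i) * f i)"
proof -
  have "f w = f (\<Sum>i\<in>Basis. (w \<bullet> i) *\<^sub>R i)" by (simp add: euclidean_representation)
  also have "\<dots> = (\<Sum>i\<in>Basis. (w \<bullet> i) * f i)"
    by (simp only: linear_sum[OF assms] linear_scale[OF assms] o_def real_scaleR_def)
  finally show ?thesis .
qed

lemma dim_orthogonal_functional:
  fixes f :: "'e::euclidean_space \<Rightarrow> real"
  assumes "linear f"
  shows "dim {a. f a = 0} \<ge> DIM('e) - 1"
proof -
  define z where "z = (\<Sum>i\<in>Basis. f i *\<^sub>R i)"
  have "f a = z \<bullet> a" for a
    using linear_euclidean[OF assms, of a]
    by (simp add: z_def inner_sum_left inner_commute[of a] mult.commute)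
  then have "{a. f a = 0} = {a. z \<bullet> a = 0}" by simp
  then show ?thesis using dim_hyperplane[of z] by (cases "z = 0") auto
qed

text \<open>\<open>L\<close> may be indefinite, so isotropic vectors have to be dealt with. The form
  \<open>\<tau>\<close> is shown to vanish on \<open>L\<close>-orthogonal pairs, then on the
  diagonal at non-isotropic vectors; splitting off a non-isotropic vector and polarizing covers the
  rest.\<close>

lemma kulkarni_nomizu_zero:
  fixes \<tau> L :: "'e::euclidean_space \<Rightarrow> 'e \<Rightarrow> real"
  assumes bt: "bilinear \<tau>" and bL: "bilinear L"
    and st: "\<And>u w. \<tau> u w = \<tau> w u" and sL: "\<And>u w. L u w = L w u"
    and ker: "\<And>u. (\<And>w. L u w = 0) \<Longrightarrow> u \<in> span {n}"
    and dim: "DIM('e) \<ge> 4"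
    and KN: "\<And>e b a c. \<tau> e b * L a c - \<tau> e c * L a b - \<tau> a b * L e c + \<tau> a c * L e b = 0"
  shows "\<tau> u w = 0"
proof -
  note bil = bilinear_ladd[OF bt] bilinear_radd[OF bt] bilinear_lmul[OF bt] bilinear_rmul[OF bt]
    bilinear_lsub[OF bt] bilinear_rsub[OF bt]
    bilinear_ladd[OF bL] bilinear_radd[OF bL] bilinear_lmul[OF bL] bilinear_rmul[OF bL]
    bilinear_lsub[OF bL] bilinear_rsub[OF bL]
  have lin: "linear (\<lambda>a. L a b)" for b using bL by (simp add: bilinear_def)
  have orth: "dim {a. L a b = 0} \<ge> 3" for b
    using dim_orthogonal_functional[OF lin[of b]] dim by simp
  have sub: "subspace {a. L a b = 0}" for b
    using linear_subspace_kernel[OF lin[of b]] .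
  \<comment> \<open>This is where dimension 4 enters: the \<open>L\<close>-orthogonal of one vector
    has dimension at least 3, so it contains a vector independent of any given \<open>e\<close>
    modulo the kernel direction \<open>n\<close>.\<close>
  have small: "\<not> {a. L a b = 0} \<subseteq> span {e, n}" for b e
  proof
    assume "{a. L a b = 0} \<subseteq> span {e, n}"
    then have "dim {a. L a b = 0} \<le> dim (span {e, n})" by (rule dim_subset)
    also have "\<dots> \<le> card {e, n}" by (simp add: dim_le_card')
    also have "\<dots> \<le> 2" by (simp add: card_insert_if)
    finally show False using orth[of b] by simp
  qed
  have vanish: "\<tau> e b = 0" if "L e b = 0" for e b
  proof (rule ccontr)
    assume ne: "\<tau> e b \<noteq> 0"
    obtain a where a: "L a b = 0" "a \<notin> span {e, n}" using small[of b e] by auto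
    \<comment> \<open>With \<open>L e b = L a b = 0\<close>, two of the four terms of the product
      drop out, and the rest says that this combination of \<open>a\<close> and \<open>e\<close>
      lies in the kernel of \<open>L\<close>. The choice of \<open>a\<close> outside
      \<open>span {e, n}\<close> contradicts this.\<close>
    have "L (\<tau> e b *\<^sub>R a - \<tau> a b *\<^sub>R e) c = 0" for c
      using KN[of e b a c] that a by (simp add: bil)
    then have "\<tau> e b *\<^sub>R a - \<tau> a b *\<^sub>R e \<in> span {n}" by (rule ker)
    then have "\<tau> e b *\<^sub>R a - \<tau> a b *\<^sub>R e \<in> span {e, n}" using span_mono[of "{n}" "{e,n}"] by auto
    moreover have "\<tau> a b *\<^sub>R e \<in> span {e, n}" by (intro span_scale span_base) simp
    ultimately have "\<tau> e b *\<^sub>R a \<in> span {e, n}" using span_diff span_add by (metis diff_add_cancel)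
    then have "(1 / \<tau> e b) *\<^sub>R (\<tau> e b *\<^sub>R a) \<in> span {e, n}" by (rule span_scale)
    then show False using ne a by simp
  qed
  have polar: "L a b = 0" if "subspace S" "a \<in> S" "b \<in> S" "\<And>c. c \<in> S \<Longrightarrow> L c c = 0" for S a b
  proof -
    have "L (a + b) (a + b) = 0" using that by (intro that(4) subspace_add)
    then show ?thesis using that(4)[OF that(2)] that(4)[OF that(3)] sL[of a b] by (simp add: bil)
  qed
  have diag: "\<tau> e e = 0" if ne: "L e e \<noteq> 0" for e
  proof -
    \<comment> \<open>Otherwise the orthogonal of \<open>e\<close> would be totally isotropic. As
      every \<open>w\<close> splits into a multiple of \<open>e\<close> and an orthogonal part, it
      would then lie in the kernel of \<open>L\<close>, which is too small.\<close>
    have "\<exists>a. L a e = 0 \<and> L a a \<noteq> 0"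
    proof (rule ccontr)
      assume "\<not> (\<exists>a. L a e = 0 \<and> L a a \<noteq> 0)"
      then have z: "L a b = 0" if "L a e = 0" "L b e = 0" for a b
        using polar[OF sub[of e], of a b] that by auto
      have "{a. L a e = 0} \<subseteq> span {n}"
      proof safe
        fix a assume a: "L a e = 0"
        show "a \<in> span {n}"
        proof (rule ker)
          fix w
          have "L (w - (L w e / L e e) *\<^sub>R e) e = 0" using ne by (simp add: bil)
          from z[OF a this] show "L a w = 0" using a by (simp add: bil)
        qed
      qed
      then show False using small[of e n] by (simp add: insert_absorb2)
    qed
    then obtain a where a: "L a e = 0" "L a a \<noteq> 0" by blast
    have ta: "\<tau> a e = 0" using vanish a by simp
    \<comment> \<open>The second vector is chosen so that \<open>L e e * L a a\<close> cancels. The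
      resulting relation and the product at \<open>e, e, a, a\<close> differ only in a sign, which
      forces both terms to vanish.\<close>
    have "L (e + a) (L a a *\<^sub>R e - L e e *\<^sub>R a) = 0"
      using a sL[of a e] by (simp add: bil)
    then have "\<tau> (e + a) (L a a *\<^sub>R e - L e e *\<^sub>R a) = 0" by (rule vanish)
    then have "\<tau> e e * L a a = \<tau> a a * L e e"
      using ta st[of a e] by (simp add: bil mult.commute)
    moreover have "\<tau> e e * L a a + \<tau> a a * L e e = 0"
      using KN[of e e a a] ta a st[of a e] sL[of a e] by simp
    ultimately have "\<tau> e e * L a a = 0" by linarith
    then show ?thesis using a by simp
  qed
  have "\<not> (\<forall>e. L e e = 0)"
  proof
    assume "\<forall>e. L e e = 0"
    then have "L a b = 0" for a b using polar[OF subspace_UNIV, of a b] by simp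
    then have "{a. L a 0 = 0} \<subseteq> span {n}" using ker by auto
    then show False using small[of 0 n] by (simp add: insert_absorb2)
  qed
  then obtain e where e: "L e e \<noteq> 0" by blast
  have row: "\<tau> x e = 0" if "L e e \<noteq> 0" for x e
  proof -
    have "L (x - (L x e / L e e) *\<^sub>R e) e = 0" using that by (simp add: bil)
    from vanish[OF this] show ?thesis using diag[OF that] by (simp add: bil)
  qed
  show ?thesis
  proof (cases "L w w = 0")
    case False
    then show ?thesis by (rule row)
  next
    case True
    \<comment> \<open>For isotropic \<open>w\<close> these two values add up to
      \<open>2 * L e e\<close>, so they cannot both vanish.\<close>
    have "L (w + e) (w + e) \<noteq> 0 \<or> L (w - e) (w - e) \<noteq> 0"
      using True e sL[of w e] by (simp add: bil)
    then have "\<tau> u (w + e) = 0 \<or> \<tau> u (w - e) = 0" using row by blast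
    then show ?thesis using row[OF e, of u] by (auto simp: bil)
  qed
qed

section \<open>Smooth dependence of solutions of linear equations\<close>

text \<open>Where \<open>f\<close> vanishes, the term of the product rule that contains the
  derivative of \<open>r\<close> disappears, so continuity of \<open>r\<close> is enough. This
  allows the inverse of a linear family, known at first only to be continuous, to be
  differentiated.\<close>

lemma has_derivative_scaleR_of_zero:
  fixes f :: "'e::real_normed_vector \<Rightarrow> real" and r :: "'e \<Rightarrow> 'f::real_normed_vector"
  assumes f: "(f has_derivative f') (at x)" and "f x = 0" and r: "continuous (at x) r"
  shows "((\<lambda>y. f y *\<^sub>R r y) has_derivative (\<lambda>v. f' v *\<^sub>R r x)) (at x)"
  unfolding has_derivative_iff_norm
proof
  have bl: "bounded_linear f'" using f has_derivative_bounded_linear by blast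
  then show "bounded_linear (\<lambda>v. f' v *\<^sub>R r x)" by (rule bounded_linear_scaleR_const)
  obtain K where K: "\<And>v. norm (f' v) \<le> norm v * K" using bounded_linear.bounded[OF bl] by blast
  have lim: "((\<lambda>y. norm (f y - f' (y - x)) / norm (y - x)) \<longlongrightarrow> 0) (at x)"
    using f \<open>f x = 0\<close> by (simp add: has_derivative_iff_norm)
  have rl: "(r \<longlongrightarrow> r x) (at x)" using r by (simp add: isCont_def)
  have "((\<lambda>y. norm (f y - f' (y - x)) / norm (y - x) * norm (r y) + \<bar>K\<bar> * norm (r y - r x))
      \<longlongrightarrow> 0 * norm (r x) + \<bar>K\<bar> * norm (r x - r x)) (at x)"
    by (intro tendsto_intros lim rl)
  then have lim': "((\<lambda>y. norm (f y - f' (y - x)) / norm (y - x) * norm (r y) + \<bar>K\<bar> * norm (r y - r x))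
      \<longlongrightarrow> 0) (at x)" by simp
  show "((\<lambda>y. norm (f y *\<^sub>R r y - f x *\<^sub>R r x - f' (y - x) *\<^sub>R r x) / norm (y - x)) \<longlongrightarrow> 0) (at x)"
  proof (rule Lim_null_comparison[OF _ lim'], rule eventuallyI)
    fix y
    show "norm (norm (f y *\<^sub>R r y - f x *\<^sub>R r x - f' (y - x) *\<^sub>R r x) / norm (y - x))
      \<le> norm (f y - f' (y - x)) / norm (y - x) * norm (r y) + \<bar>K\<bar> * norm (r y - r x)"
    proof (cases "y = x")
      case False
      have "f y *\<^sub>R r y - f x *\<^sub>R r x - f' (y - x) *\<^sub>R r x
          = (f y - f' (y - x)) *\<^sub>R r y + f' (y - x) *\<^sub>R (r y - r x)"
        using \<open>f x = 0\<close> by (simp add: algebra_simps)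
      then have "norm (f y *\<^sub>R r y - f x *\<^sub>R r x - f' (y - x) *\<^sub>R r x)
          \<le> norm (f y - f' (y - x)) * norm (r y) + norm (f' (y - x)) * norm (r y - r x)"
        by (metis norm_triangle_ineq norm_scaleR real_norm_def)
      also have "norm (f' (y - x)) \<le> norm (y - x) * \<bar>K\<bar>"
        using K[of "y - x"] by (smt (verit) mult_left_mono norm_ge_zero)
      finally have "norm (f y *\<^sub>R r y - f x *\<^sub>R r x - f' (y - x) *\<^sub>R r x)
          \<le> norm (f y - f' (y - x)) * norm (r y) + norm (y - x) * \<bar>K\<bar> * norm (r y - r x)"
        by (simp add: mult_right_mono)
      then show ?thesis using False by (simp add: field_simps)
    qed simp
  qed
qed

text \<open>The inverse is compared with its value at a nearby point through the residual of the old
  solution (\<open>step\<close>). A uniform lower bound for \<open>M x\<close> gives continuity, the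
  vanishing of the residual gives differentiability, and the resulting formula for the derivative
  gives all higher orders.\<close>

lemma smooth_linear_solution:
  fixes M :: "'e::euclidean_space \<Rightarrow> 'f::euclidean_space \<Rightarrow> 'f"
  assumes W: "open W" "x0 \<in> W" and lin: "\<And>x. x \<in> W \<Longrightarrow> linear (M x)"
    and sm: "\<And>y. smooth_on W (\<lambda>x. M x y)" and inj: "inj (M x0)"
  obtains V R where "open V" "x0 \<in> V" "V \<subseteq> W" "\<And>x. x \<in> V \<Longrightarrow> inj (M x)"
    "\<And>x y. x \<in> V \<Longrightarrow> M x (R x y) = y" "\<And>y. smooth_on V (\<lambda>x. R x y)"
proof -
  obtain B where B: "B > 0" "\<And>y. B * norm y \<le> norm (M x0 y)"
    using linear_inj_bounded_below_pos[OF lin[OF W(2)] inj] by blast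
  \<comment> \<open>A bound for the operator norm of \<open>M x - M x0\<close> that is visibly
    continuous and vanishes at \<open>x0\<close>.\<close>
  define \<eta> where "\<eta> x = (\<Sum>j\<in>Basis. norm (M x j - M x0 j))" for x
  have exp: "M x y = (\<Sum>j\<in>Basis. (y \<bullet> j) *\<^sub>R M x j)" if "x \<in> W" for x y
  proof -
    have "M x y = M x (\<Sum>j\<in>Basis. (y \<bullet> j) *\<^sub>R j)" by (simp add: euclidean_representation)
    also have "\<dots> = (\<Sum>j\<in>Basis. (y \<bullet> j) *\<^sub>R M x j)"
      by (simp only: linear_sum[OF lin[OF that]] linear_scale[OF lin[OF that]] o_def)
    finally show ?thesis .
  qed
  have bd: "norm (M x y - M x0 y) \<le> \<eta> x * norm y" if "x \<in> W" for x y
  proof -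
    have "M x y - M x0 y = (\<Sum>j\<in>Basis. (y \<bullet> j) *\<^sub>R (M x j - M x0 j))"
      unfolding exp[OF that, of y] exp[OF W(2), of y]
      by (simp add: sum_subtractf scaleR_right_diff_distrib)
    also have "norm \<dots> \<le> (\<Sum>j\<in>Basis. norm y * norm (M x j - M x0 j))"
      by (rule sum_norm_le) (auto intro!: mult_right_mono Basis_le_norm)
    finally show ?thesis by (simp add: \<eta>_def sum_distrib_left mult.commute)
  qed
  have \<eta>c: "continuous_on W \<eta>"
    unfolding \<eta>_def by (intro continuous_intros smooth_on_continuous_on[OF sm])
  \<comment> \<open>A perturbation below \<open>B / 2\<close> leaves half of the lower bound
    \<open>B\<close> to every \<open>M x\<close>.\<close>
  define V where "V = W \<inter> \<eta> -` {..<B / 2}"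
  have V: "open V" unfolding V_def by (rule continuous_open_preimage[OF \<eta>c W(1)]) simp
  have "\<eta> x0 = 0" by (simp add: \<eta>_def)
  then have x0: "x0 \<in> V" using W B by (simp add: V_def)
  have VW: "V \<subseteq> W" by (auto simp: V_def)
  have low: "B / 2 * norm y \<le> norm (M x y)" if "x \<in> V" for x y
  proof -
    have "x \<in> W" "\<eta> x < B / 2" using that by (auto simp: V_def)
    then have "norm (M x y - M x0 y) \<le> B / 2 * norm y"
      using bd[of x y] by (meson less_imp_le mult_right_mono norm_ge_zero order_trans)
    moreover have "norm (M x0 y) \<le> norm (M x y) + norm (M x y - M x0 y)"
      by (metis norm_minus_commute norm_triangle_sub)
    moreover have "B * norm y \<le> norm (M x0 y)" by (rule B)
    ultimately show ?thesis by (simp add: field_simps)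
  qed
  have injV: "inj (M x)" if "x \<in> V" for x
  proof -
    have "linear (M x)" using that lin VW by blast
    moreover have "y = 0" if "M x y = 0" for y
      using low[OF \<open>x \<in> V\<close>, of y] that B by (simp add: mult_le_0_iff)
    ultimately show ?thesis using linear_injective_0 by blast
  qed
  define R where "R x = inv (M x)" for x
  have MR: "M x (R x y) = y" if "x \<in> V" for x y
  proof -
    have "surj (M x)"
      using linear_injective_imp_surjective[OF _ injV[OF that]] lin that VW by blast
    then show ?thesis by (simp add: R_def surj_f_inv_f)
  qed
  have RM: "R x (M x y) = y" if "x \<in> V" for x y
    using injV[OF that] by (simp add: R_def)
  have linR: "linear (R x)" if "x \<in> V" for x
  proof (rule linearI)
    have l: "linear (M x)" using that lin VW by blast
    show "R x (a + b) = R x a + R x b" for a b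
      by (rule injD[OF injV[OF that]]) (simp add: MR that linear_add[OF l])
    show "R x (c *\<^sub>R b) = c *\<^sub>R R x b" for c b
      by (rule injD[OF injV[OF that]]) (simp add: MR that linear_scale[OF l])
  qed
  have Rbd: "norm (R x y) \<le> 2 / B * norm y" if "x \<in> V" for x y
    using low[OF that, of "R x y"] MR[OF that, of y] B by (simp add: field_simps)
  \<comment> \<open>The resolvent identity: the old solution corrected by the inverse applied to its
    residual, which vanishes at \<open>x = x1\<close>.\<close>
  have step: "R x y = R x1 y + R x (y - M x (R x1 y))" if "x \<in> V" for x x1 y
    by (simp add: RM linear_diff[OF linR] that)
  have smV: "smooth_on V (\<lambda>x. M x y)" for y using sm VW smooth_on_subset by blast
  have Rcont: "continuous (at x1) (\<lambda>x. R x y)" if "x1 \<in> V" for x1 y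
  proof -
    have "continuous (at x1) (\<lambda>x. M x (R x1 y))"
      using smooth_on_continuous_on[OF smV] V that continuous_on_eq_continuous_at by blast
    then have "((\<lambda>x. M x (R x1 y)) \<longlongrightarrow> y) (at x1)"
      using MR[OF that] by (simp add: isCont_def)
    then have "((\<lambda>x. 2 / B * norm (y - M x (R x1 y))) \<longlongrightarrow> 2 / B * norm (y - y)) (at x1)"
      by (intro tendsto_intros)
    then have lim: "((\<lambda>x. 2 / B * norm (y - M x (R x1 y))) \<longlongrightarrow> 0) (at x1)" by simp
    have ev: "\<forall>\<^sub>F x in at x1. norm (R x y - R x1 y) \<le> 2 / B * norm (y - M x (R x1 y))"
      using eventually_at_in_open'[OF V that]
    proof eventually_elim
      case (elim x)
      then show ?case using step[of x y x1] Rbd[of x "y - M x (R x1 y)"] by simp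
    qed
    show ?thesis
      using Lim_null_comparison[OF ev lim] LIM_zero_iff unfolding isCont_def by blast
  qed
  have Rder: "((\<lambda>x. R x y) has_derivative (\<lambda>v. \<Sum>i\<in>Basis.
      ((- (\<Sum>j\<in>Basis. (R x1 y \<bullet> j) *\<^sub>R dd v (\<lambda>x. M x j) x1)) \<bullet> i) *\<^sub>R R x1 i)) (at x1)"
    if "x1 \<in> V" for x1 y
  proof (rule has_derivative_transform_within_open[OF _ V that])
    \<comment> \<open>The residual. Its basis expansion leaves \<open>R x\<close> acting on fixed
      vectors only, with coefficients that vanish at \<open>x1\<close>.\<close>
    define \<phi> where "\<phi> x = y - (\<Sum>j\<in>Basis. (R x1 y \<bullet> j) *\<^sub>R M x j)" for x
    have \<phi>M: "\<phi> x = y - M x (R x1 y)" if "x \<in> V" for x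
      using exp[of x "R x1 y"] that VW by (auto simp: \<phi>_def)
    have d\<phi>: "(\<phi> has_derivative (\<lambda>v. - (\<Sum>j\<in>Basis. (R x1 y \<bullet> j) *\<^sub>R dd v (\<lambda>x. M x j) x1))) (at x1)"
      unfolding \<phi>_def
      by (rule derivative_eq_intros has_derivative_dd smooth_on_differentiable[OF smV that] refl | simp)+
    show "((\<lambda>x. R x1 y + (\<Sum>i\<in>Basis. (\<phi> x \<bullet> i) *\<^sub>R R x i)) has_derivative (\<lambda>v. \<Sum>i\<in>Basis.
      ((- (\<Sum>j\<in>Basis. (R x1 y \<bullet> j) *\<^sub>R dd v (\<lambda>x. M x j) x1)) \<bullet> i) *\<^sub>R R x1 i)) (at x1)"
      (is "(_ has_derivative ?D) _")
    proof -
      have "((\<lambda>x. \<Sum>i\<in>Basis. (\<phi> x \<bullet> i) *\<^sub>R R x i) has_derivative ?D) (at x1)"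
      proof (rule has_derivative_sum, rule has_derivative_scaleR_of_zero)
        fix i :: 'f
        show "((\<lambda>x. \<phi> x \<bullet> i) has_derivative
           (\<lambda>v. (- (\<Sum>j\<in>Basis. (R x1 y \<bullet> j) *\<^sub>R dd v (\<lambda>x. M x j) x1)) \<bullet> i)) (at x1)"
          by (rule has_derivative_inner_left[OF d\<phi>])
        show "\<phi> x1 \<bullet> i = 0" using \<phi>M[OF that] MR[OF that] by simp
        show "continuous (at x1) (\<lambda>x. R x i)" by (rule Rcont[OF that])
      qed
      from has_derivative_add[OF has_derivative_const this] show ?thesis by simp
    qed
    show "R x1 y + (\<Sum>i\<in>Basis. (\<phi> x \<bullet> i) *\<^sub>R R x i) = R x y" if "x \<in> V" for x
    proof -
      have "R x (\<phi> x) = R x (\<Sum>i\<in>Basis. (\<phi> x \<bullet> i) *\<^sub>R i)" by (simp add: euclidean_representation)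
      also have "\<dots> = (\<Sum>i\<in>Basis. (\<phi> x \<bullet> i) *\<^sub>R R x i)"
        by (simp only: linear_sum[OF linR[OF that]] linear_scale[OF linR[OF that]] o_def)
      finally show ?thesis using step[OF that, of y x1] \<phi>M[OF that] by simp
    qed
  qed
  \<comment> \<open>Bootstrap: the derivative of \<open>R\<close> is polynomial in \<open>R\<close>
    and smooth in the rest, so each order of regularity yields the next. \<open>y\<close> must vary
    because the values at all basis vectors occur.\<close>
  have "Ck_on k V (\<lambda>x. R x y)" for k y
  proof (induction k arbitrary: y)
    case 0
    show ?case using Rcont by (simp add: continuous_at_imp_continuous_on)
  next
    case (Suc k)
    have "Ck_on k V (dd v (\<lambda>x. R x y))" for v
    proof (rule Ck_on_cong[OF V])
      have c1: "Ck_on k V (\<lambda>x. (R x y \<bullet> j) *\<^sub>R dd v (\<lambda>x. M x j) x)" for j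
        using smooth_on_dd[OF smV] Suc.IH[of y]
        by (intro Ck_on_bilinear[OF V bounded_bilinear_scaleR]
            Ck_on_bounded_linear[OF V bounded_linear_inner_left]) (auto simp: smooth_on_def)
      have c2: "Ck_on k V (\<lambda>x. (\<Sum>j\<in>Basis. (R x y \<bullet> j) *\<^sub>R dd v (\<lambda>x. M x j) x) \<bullet> (- i))" for i
        by (rule Ck_on_bounded_linear[OF V bounded_linear_inner_left Ck_on_sum[OF V c1]])
      show "Ck_on k V (\<lambda>x. \<Sum>i\<in>Basis.
          ((\<Sum>j\<in>Basis. (R x y \<bullet> j) *\<^sub>R dd v (\<lambda>x. M x j) x) \<bullet> (- i)) *\<^sub>R R x i)"
        by (intro Ck_on_sum[OF V] Ck_on_bilinear[OF V bounded_bilinear_scaleR c2 Suc.IH])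
      show "(\<Sum>i\<in>Basis. ((\<Sum>j\<in>Basis. (R x y \<bullet> j) *\<^sub>R dd v (\<lambda>x. M x j) x) \<bullet> (- i)) *\<^sub>R R x i)
          = dd v (\<lambda>x. R x y) x" if "x \<in> V" for x
        using dd_eqI[OF Rder[OF that]] by simp
    qed
    moreover have "(\<lambda>x. R x y) differentiable (at x)" if "x \<in> V" for x
      using Rder[OF that] differentiable_def by blast
    ultimately show ?case by (simp add: Ck_on_Suc)
  qed
  then have "smooth_on V (\<lambda>x. R x y)" for y by (simp add: smooth_on_def)
  with V x0 VW injV MR show thesis by (rule that)
qed

section \<open>The null line of a degenerate form and its smooth generator\<close>

lemma null_space_subspace: "bilinear B \<Longrightarrow> subspace (null_space B)"
  by (auto simp: null_space_def subspace_def bilinear_lzero bilinear_ladd bilinear_lmul)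

lemma line_generated_by_unit:
  fixes S :: "'e::euclidean_space set"
  assumes "subspace S" "dim S = 1"
  obtains n where "n \<bullet> n = 1" "S = span {n}"
proof -
  have "\<not> S \<subseteq> {0}" using assms(2) dim_eq_0[of S] by simp
  then obtain m where m: "m \<in> S" "m \<noteq> 0" by blast
  define n where "n = m /\<^sub>R norm m"
  have n: "n \<in> S" "norm n = 1" using m assms(1) by (auto simp: n_def subspace_scale)
  have "span {n} \<subseteq> S" using n assms(1) by (simp add: span_minimal)
  moreover have "dim (span {n}) = 1" using n by (auto simp: dim_singleton)
  ultimately have "span {n} = S"
    using subspace_dim_equal[of "span {n}" S] assms by simp
  moreover have "n \<bullet> n = 1" using n by (simp add: dot_square_norm)
  ultimately show thesis using that by blast
qed

text \<open>The operator representing the form \<open>B\<close> plus the square of the functional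
  given by \<open>n\<close>. The rank-one term fills the null direction, so that a degenerate form
  can be handled by inverting a linear map.\<close>

definition completed :: "('e::euclidean_space \<Rightarrow> 'e \<Rightarrow> real) \<Rightarrow> 'e \<Rightarrow> 'e \<Rightarrow> 'e" where
  "completed B n y = (\<Sum>i\<in>Basis. B y i *\<^sub>R i) + (n \<bullet> y) *\<^sub>R n"

lemma completed_inner:
  assumes "bilinear B"
  shows "completed B n y \<bullet> w = B y w + (n \<bullet> y) * (n \<bullet> w)"
proof -
  have "B y w = (\<Sum>i\<in>Basis. B y i *\<^sub>R i) \<bullet> w"
    using assms linear_euclidean[of "B y" w]
    by (simp add: bilinear_def inner_sum_left inner_commute[of w] mult.commute)
  then show ?thesis by (simp add: completed_def inner_add_left)
qed

lemma linear_completed: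
  assumes "bilinear B"
  shows "linear (completed B n)"
  by (rule linearI) (simp_all add: completed_def bilinear_ladd[OF assms] bilinear_lmul[OF assms]
      inner_add_right scaleR_add_left sum.distrib scaleR_add_right scaleR_sum_right)

lemma inj_completed:
  assumes "bilinear B" "\<And>u w. B u w = B w u" "n \<bullet> n = 1" "null_space B = span {n}"
  shows "inj (completed B n)"
  unfolding linear_injective_0[OF linear_completed[OF assms(1)]]
proof safe
  fix y assume y: "completed B n y = 0"
  have "n \<in> null_space B" using assms(4) by (simp add: span_base)
  then have "n \<bullet> y = 0"
    using completed_inner[OF assms(1), of n y n] y assms(2)[of y n] assms(3)
    by (simp add: null_space_def)
  then have "y \<in> null_space B"
    using completed_inner[OF assms(1), of n y] y by (simp add: null_space_def)
  then obtain c where "y = c *\<^sub>R n" using assms(4) by (auto simp: span_singleton)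
  with \<open>n \<bullet> y = 0\<close> assms(3) show "y = 0" by simp
qed

text \<open>Near \<open>x0\<close> the null direction is spanned by the solution \<open>X\<close> of \<open>G X + (n \<bullet> X) n = n\<close>,
  where \<open>n\<close> is a unit null vector at \<open>x0\<close>.\<close>

lemma smooth_null_field:
  fixes G :: "'e::euclidean_space form_field"
  assumes \<Omega>: "open \<Omega>" "x0 \<in> \<Omega>" and bil: "\<And>x. x \<in> \<Omega> \<Longrightarrow> bilinear (G x)"
    and sym: "\<And>x u w. x \<in> \<Omega> \<Longrightarrow> G x u w = G x w u"
    and sm: "\<And>u w. smooth_on \<Omega> (\<lambda>x. G x u w)"
    and null: "\<And>x. x \<in> \<Omega> \<Longrightarrow> dim (null_space (G x)) = 1"
  obtains W X n where "open W" "x0 \<in> W" "W \<subseteq> \<Omega>" "smooth_on W X" "n \<bullet> n = 1"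
    "null_space (G x0) = span {n}" "X x0 = n"
    "\<And>x. x \<in> W \<Longrightarrow> X x \<bullet> n = 1" "\<And>x. x \<in> W \<Longrightarrow> X x \<in> null_space (G x)"
proof -
  obtain n where n: "n \<bullet> n = 1" "null_space (G x0) = span {n}"
    using line_generated_by_unit[OF null_space_subspace[OF bil[OF \<Omega>(2)]] null[OF \<Omega>(2)]] by blast
  define M where "M x = completed (G x) n" for x
  have lin: "linear (M x)" if "x \<in> \<Omega>" for x
    unfolding M_def using linear_completed[OF bil[OF that]] .
  have smM: "smooth_on \<Omega> (\<lambda>x. M x y)" for y
    unfolding M_def completed_def
    by (intro smooth_on_add smooth_on_sum smooth_on_scaleR smooth_on_const sm \<Omega>)
  have injM: "inj (M x0)"
    unfolding M_def using inj_completed[OF bil[OF \<Omega>(2)] sym[OF \<Omega>(2)] n] .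
  obtain W R where W: "open W" "x0 \<in> W" "W \<subseteq> \<Omega>" and inj: "\<And>x. x \<in> W \<Longrightarrow> inj (M x)"
    and MR: "\<And>x y. x \<in> W \<Longrightarrow> M x (R x y) = y" and smR: "\<And>y. smooth_on W (\<lambda>x. R x y)"
    using smooth_linear_solution[OF \<Omega> lin smM injM] by metis
  have X: "R x n \<bullet> n = 1 \<and> R x n \<in> null_space (G x)" if x: "x \<in> W" for x
  proof -
    have x\<Omega>: "x \<in> \<Omega>" using x W by auto
    obtain m where m: "m \<bullet> m = 1" "null_space (G x) = span {m}"
      using line_generated_by_unit[OF null_space_subspace[OF bil[OF x\<Omega>]] null[OF x\<Omega>]] by blast
    have mn: "m \<in> null_space (G x)" using m by (simp add: span_base)
    \<comment> \<open>On a null vector only the rank-one term survives. Injectivity of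
      \<open>M x\<close> makes the factor \<open>n \<bullet> m\<close> nonzero, so the solution for
      \<open>n\<close> is a rescaled null vector.\<close>
    have Mm: "M x m = (n \<bullet> m) *\<^sub>R n" using mn by (simp add: M_def completed_def null_space_def)
    have "n \<bullet> m \<noteq> 0"
    proof
      assume "n \<bullet> m = 0"
      then have "m = 0" using Mm inj[OF x] linear_injective_0[OF lin[OF x\<Omega>]] by auto
      then show False using m by simp
    qed
    have "M x ((1 / (n \<bullet> m)) *\<^sub>R m) = n"
      using linear_scale[OF lin[OF x\<Omega>]] Mm \<open>n \<bullet> m \<noteq> 0\<close> by simp
    then have "R x n = (1 / (n \<bullet> m)) *\<^sub>R m"
      using injD[OF inj[OF x]] MR[OF x] by metis
    then show ?thesis
      using mn \<open>n \<bullet> m \<noteq> 0\<close> subspace_scale[OF null_space_subspace[OF bil[OF x\<Omega>]]]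
      by (simp add: inner_commute)
  qed
  have "R x0 n = n"
  proof -
    obtain c where "R x0 n = c *\<^sub>R n" using X[OF W(2)] n by (auto simp: span_singleton)
    then show ?thesis using X[OF W(2)] n by simp
  qed
  with W smR[of n] n X show thesis using that by blast
qed

section \<open>Approximate Killing equations\<close>

text \<open>The symmetrized gradient determines all second derivatives, so nothing is lost against
  the full gradient: order k + 1 for it gives order k + 2 for \<open>\<omega>\<close>.\<close>

lemma flat_of_symmetrized_gradient:
  fixes \<omega> :: "'e::euclidean_space \<Rightarrow> 'e \<Rightarrow> real"
  assumes W: "open W" "x \<in> W" and sm: "\<And>w. smooth_on W (\<omega> w)"
    and grad: "\<And>u w. flat (Suc k) (\<lambda>x. dd u (\<omega> w) x + dd w (\<omega> u) x) x"
    and flat2: "\<And>w. flat 2 (\<omega> w) x"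
  shows "flat (k + 2) (\<omega> w) x"
proof (rule flat_of_dd2[OF flat2])
  fix a u
  define t where "t a u w = dd a (dd u (\<omega> w))" for a u w
  have smt: "smooth_on W (t a u w)" for a u w
    unfolding t_def by (intro smooth_on_dd sm)
  have t_sym: "t a u w y = t u a w y" if "y \<in> W" for a u w y
    unfolding t_def by (rule dd_commute[OF W(1) sm that])
  have pair: "flat k (\<lambda>x. t a u w x + t a w u x) x" for a u w
  proof (rule flat_cong[OF W])
    show "flat k (dd a (\<lambda>x. dd u (\<omega> w) x + dd w (\<omega> u) x)) x"
      by (rule flat_dd[OF W smooth_on_add[OF W(1) smooth_on_dd[OF sm] smooth_on_dd[OF sm]] grad])
    show "dd a (\<lambda>x. dd u (\<omega> w) x + dd w (\<omega> u) x) y = t a u w y + t a w u y" if "y \<in> W" for y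
      unfolding t_def
      by (rule dd_add; rule smooth_on_differentiable[OF smooth_on_dd[OF sm] that])
  qed
  \<comment> \<open>The alternating sum of the Koszul formula. By symmetry of \<open>t\<close> in
    its first two arguments it equals \<open>t a u w\<close>.\<close>
  have "flat k (\<lambda>x. 1/2 * (((t a u w x + t a w u x) + (t u a w x + t u w a x))
      - (t w a u x + t w u a x))) x"
    by (rule flat_bounded_linear[OF W bounded_linear_mult_right])
      (intro smooth_on_diff[OF W(1)] smooth_on_add[OF W(1)] smt
        flat_diff[OF W] flat_add[OF W] pair)+
  then show "flat k (dd a (dd u (\<omega> w))) x"
    by (rule flat_cong[OF W, rotated])
      (use t_sym in \<open>simp add: t_def\<close>)
qed

text \<open>The hypothesis says that \<open>- \<nu> L\<close> is, up to the given order, a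
  symmetrized gradient. Saint-Venant compatibility eliminates \<open>\<eta>\<close> at the price of
  two derivatives and leaves a purely algebraic condition on the Hessian of
  \<open>\<nu>\<close>.\<close>

lemma flat_of_killing_defect:
  fixes \<eta> :: "'e::euclidean_space \<Rightarrow> 'e \<Rightarrow> real" and L :: "'e \<Rightarrow> 'e \<Rightarrow> real"
  assumes W: "open W" "x \<in> W" and sm: "\<And>w. smooth_on W (\<eta> w)" and sm\<nu>: "smooth_on W \<nu>"
    and killing: "\<And>u w. flat (k + 2) (\<lambda>x. dd u (\<eta> w) x + dd w (\<eta> u) x + \<nu> x * L u w) x"
    and flat2: "flat 2 \<nu> x"
    and L: "bilinear L" "\<And>u w. L u w = L w u" "\<And>u. (\<And>w. L u w = 0) \<Longrightarrow> u \<in> span {n}"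
    and dim: "DIM('e) \<ge> 4"
  shows "flat (k + 2) \<nu> x"
proof (rule flat_of_dd2[OF flat2])
  fix a b
  show "flat k (dd a (dd b \<nu>)) x"
    unfolding flat_def
  proof safe
    fix bs assume bs: "set bs \<subseteq> (Basis :: 'e set)" "length bs < k"
    \<comment> \<open>At a fixed multi-index the jets become numbers: \<open>\<tau>\<close> comes
      from the Hessian of \<open>\<nu>\<close>, \<open>T\<close> from the third derivatives of
      \<open>\<eta>\<close>, and the algebraic lemma applies to \<open>\<tau>\<close>.\<close>
    define \<tau> where "\<tau> a b = iter_deriv bs (dd a (dd b \<nu>)) x" for a b
    define T where "T a b u w = iter_deriv bs (dd a (dd b (dd u (\<eta> w)))) x" for a b u w
    have T1: "T a b u w = T b a u w" for a b u w
      unfolding T_def by (rule iter_deriv_cong[OF W]) (rule dd_commute[OF W(1) smooth_on_dd[OF sm]])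
    have T2: "T a b u w = T a u b w" for a b u w
      unfolding T_def
      by (rule iter_deriv_cong[OF W], rule dd_cong[OF W(1)], assumption, rule dd_commute[OF W(1) sm])
    have \<tau>_sym: "\<tau> a b = \<tau> b a" for a b
      unfolding \<tau>_def by (rule iter_deriv_cong[OF W]) (rule dd_commute[OF W(1) sm\<nu>])
    have rel: "T a b u w + T a b w u + \<tau> a b * L u w = 0" for a b u w
    proof -
      define H where "H x = dd u (\<eta> w) x + dd w (\<eta> u) x + \<nu> x * L u w" for x
      have smH: "smooth_on W H"
        unfolding H_def
        by (intro smooth_on_add[OF W(1)] smooth_on_mult[OF W(1)] smooth_on_dd sm sm\<nu> smooth_on_const)
      have "flat (Suc (Suc k)) H x" using killing[of u w] by (simp add: H_def[abs_def])
      then have "flat k (dd a (dd b H)) x"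
        by (intro flat_dd[OF W] smooth_on_dd smH)
      then have "iter_deriv bs (dd a (dd b H)) x = 0" using bs by (simp add: flat_def)
      also have "iter_deriv bs (dd a (dd b H)) x
        = iter_deriv bs (\<lambda>x. dd a (dd b (dd u (\<eta> w))) x + dd a (dd b (dd w (\<eta> u))) x
            + dd a (dd b \<nu>) x * L u w) x"
      proof (rule iter_deriv_cong[OF W])
        fix y assume y: "y \<in> W"
        have lin: "dd c (\<lambda>x. p x + q x + r x * L u w) z = dd c p z + dd c q z + dd c r z * L u w"
          if "smooth_on W p" "smooth_on W q" "smooth_on W r" "z \<in> W" for c p q r z
        proof -
          have 1: "smooth_on W (\<lambda>x. r x * L u w)"
            by (intro smooth_on_mult[OF W(1)] that smooth_on_const)
          have "dd c (\<lambda>x. (p x + q x) + r x * L u w) z = dd c p z + dd c q z + dd c (\<lambda>x. r x * L u w) z"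
            using that 1
            by (subst dd_add) (auto intro!: dd_add smooth_on_differentiable smooth_on_add[OF W(1)])
          also have "dd c (\<lambda>x. r x * L u w) z = dd c r z * L u w"
            by (rule dd_bounded_linear[OF bounded_linear_mult_left smooth_on_differentiable[OF that(3,4)]])
          finally show ?thesis .
        qed
        have "dd a (dd b H) y = dd a (\<lambda>x. dd b (dd u (\<eta> w)) x + dd b (dd w (\<eta> u)) x + dd b \<nu> x * L u w) y"
          unfolding H_def[abs_def]
          by (rule dd_cong[OF W(1) y]) (intro lin smooth_on_dd sm sm\<nu>)
        also have "\<dots> = dd a (dd b (dd u (\<eta> w))) y + dd a (dd b (dd w (\<eta> u))) y + dd a (dd b \<nu>) y * L u w"
          by (intro lin smooth_on_dd sm sm\<nu> y)
        finally show "dd a (dd b H) y = \<dots>" .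
      qed
      also have "\<dots> = T a b u w + T a b w u + \<tau> a b * L u w"
      proof -
        have s: "smooth_on W (\<lambda>x. dd a (dd b \<nu>) x * L u w)"
          by (intro smooth_on_mult[OF W(1)] smooth_on_dd sm\<nu> smooth_on_const)
        show ?thesis
          unfolding T_def \<tau>_def
          using iter_deriv_add[OF W(1) smooth_on_add[OF W(1) smooth_on_dd[OF smooth_on_dd[OF smooth_on_dd[OF sm]]]
                smooth_on_dd[OF smooth_on_dd[OF smooth_on_dd[OF sm]]]] s W(2), of bs a b u w a b w u]
            iter_deriv_add[OF W(1) smooth_on_dd[OF smooth_on_dd[OF smooth_on_dd[OF sm]]]
                smooth_on_dd[OF smooth_on_dd[OF smooth_on_dd[OF sm]]] W(2), of bs a b u w a b w u]
            iter_deriv_bounded_linear[OF W(1) bounded_linear_mult_left smooth_on_dd[OF smooth_on_dd[OF sm\<nu>]] W(2),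
              of bs a b "L u w"]
          by simp
      qed
      finally show ?thesis by simp
    qed
    \<comment> \<open>\<open>T\<close> is totally symmetric in its first three arguments, so in this
      alternating sum of four instances of \<open>rel\<close> its eight terms cancel in
      pairs.\<close>
    have KN: "\<tau> e b * L a c - \<tau> e c * L a b - \<tau> a b * L e c + \<tau> a c * L e b = 0" for e b a c
      using rel[of e b a c] rel[of e c a b] rel[of a b e c] rel[of a c e b]
        T1[of e a b c] T2[of e b a c] T2[of a b e c] T2[of e b c a] T1[of b e c a] T2[of e c b a]
        T2[of e c a b] T1[of e a c b] T2[of a c e b] T2[of a b c e] T2[of a c b e]
      by linarith
    have lin: "linear (\<lambda>a. \<tau> a b)" for b
    proof (rule linearI)
      fix p q :: 'e and c :: real
      have "\<tau> (p + q) b = iter_deriv bs (\<lambda>x. dd p (dd b \<nu>) x + dd q (dd b \<nu>) x) x"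
        unfolding \<tau>_def
        by (rule iter_deriv_cong[OF W])
          (rule linear_add[OF dd_linear[OF smooth_on_differentiable[OF smooth_on_dd[OF sm\<nu>]]]])
      also have "\<dots> = \<tau> p b + \<tau> q b"
        unfolding \<tau>_def by (intro iter_deriv_add[OF W(1) _ _ W(2)] smooth_on_dd sm\<nu>)
      finally show "\<tau> (p + q) b = \<tau> p b + \<tau> q b" .
      have "\<tau> (c *\<^sub>R p) b = iter_deriv bs (\<lambda>x. c *\<^sub>R dd p (dd b \<nu>) x) x"
        unfolding \<tau>_def
        by (rule iter_deriv_cong[OF W])
          (rule linear_scale[OF dd_linear[OF smooth_on_differentiable[OF smooth_on_dd[OF sm\<nu>]]]])
      also have "\<dots> = c *\<^sub>R \<tau> p b"
        unfolding \<tau>_def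
        by (rule iter_deriv_bounded_linear[OF W(1) bounded_linear_scaleR_right _ W(2)])
          (intro smooth_on_dd sm\<nu>)
      finally show "\<tau> (c *\<^sub>R p) b = c *\<^sub>R \<tau> p b" .
    qed
    have "\<tau> a = (\<lambda>b. \<tau> b a)" for a by (rule ext) (rule \<tau>_sym)
    with lin have "linear (\<tau> a)" for a by metis
    with lin have "bilinear \<tau>" by (simp add: bilinear_def)
    from kulkarni_nomizu_zero[OF this L(1) \<tau>_sym L(2,3) dim KN]
    show "iter_deriv bs (dd a (dd b \<nu>)) x = 0" by (simp add: \<tau>_def)
  qed
qed

section \<open>Approximate isometries in coordinates\<close>

lemma bilinear_euclidean:
  fixes B :: "'e::euclidean_space \<Rightarrow> 'e \<Rightarrow> real"
  assumes "bilinear B"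
  shows "B u w = (\<Sum>i\<in>Basis. (u \<bullet> i) * (\<Sum>j\<in>Basis. (w \<bullet> j) * B i j))"
proof -
  have "B u w = (\<Sum>i\<in>Basis. (u \<bullet> i) * B i w)"
    using assms linear_euclidean[of "\<lambda>u. B u w" u] by (simp add: bilinear_def)
  moreover have "B i w = (\<Sum>j\<in>Basis. (w \<bullet> j) * B i j)" for i
    using assms linear_euclidean[of "B i" w] by (simp add: bilinear_def)
  ultimately show ?thesis by simp
qed

text \<open>\<open>F\<close> moves points, so two sets are kept: \<open>W\<close> carries the fixed
  point, \<open>\<Omega>\<close> the images. The assumption \<open>flat_F\<close> is the trivial
  \<open>d\<close>-jet.\<close>

locale near_identity =
  fixes \<Omega> W :: "'e::euclidean_space set" and x0 :: 'e and F :: "'e \<Rightarrow> 'e" and d :: nat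
  assumes open_W: "open W" and x0: "x0 \<in> W" and W_sub: "W \<subseteq> \<Omega>" and F_maps: "F ` W \<subseteq> \<Omega>"
    and smooth_F: "smooth_on W F" and F_x0: "F x0 = x0" and d_pos: "d \<ge> 1"
    and flat_F: "flat (Suc d) (\<lambda>x. F x - x) x0"
begin

definition V :: "'e \<Rightarrow> 'e" where "V x = F x - x"

lemmas sm_add = smooth_on_add[OF open_W]
  and sm_diff = smooth_on_diff[OF open_W]
  and sm_mult = smooth_on_mult[OF open_W]
  and sm_scaleR = smooth_on_scaleR[OF open_W]
  and sm_sum = smooth_on_sum[OF open_W]
  and sm_inner = smooth_on_inner[OF open_W]
  and fl_cong = flat_cong[OF open_W x0]
  and fl_add = flat_add[OF open_W x0]
  and fl_diff = flat_diff[OF open_W x0]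
  and fl_mult = flat_mult[OF open_W x0]
  and fl_scaleR = flat_scaleR[OF open_W x0]
  and fl_sum = flat_sum[OF open_W x0]
  and fl_inner = flat_inner[OF open_W x0]
  and fl_dd = flat_dd[OF open_W x0]

lemma flat_V: "flat (Suc d) V x0"
  using flat_F by (simp add: V_def[abs_def])

lemma smooth_V: "smooth_on W V"
  unfolding V_def[abs_def] by (intro sm_diff smooth_F smooth_on_ident)

lemma dd_F: "x \<in> W \<Longrightarrow> dd b F x = b + dd b V x"
  unfolding V_def[abs_def]
  by (simp add: dd_diff smooth_on_differentiable[OF smooth_F])

lemma smooth_comp: "smooth_on \<Omega> f \<Longrightarrow> smooth_on W (\<lambda>x. f (F x))"
  by (rule smooth_on_compose[OF open_W smooth_F _ F_maps])

lemma smooth_restrict: "smooth_on \<Omega> f \<Longrightarrow> smooth_on W f"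
  using W_sub smooth_on_subset by blast

lemma smooth_dd_V: "smooth_on W (\<lambda>x. dd u V x \<bullet> a)"
  by (intro sm_inner smooth_on_dd smooth_V)

lemma flat_dd_V: "flat d (\<lambda>x. dd u V x \<bullet> a) x0"
  by (intro fl_inner smooth_on_dd smooth_V fl_dd flat_V)

lemma flat_V_inner: "flat (Suc d) (\<lambda>x. V x \<bullet> a) x0"
  by (intro fl_inner smooth_V flat_V)

lemma flat_sum_mult:
  fixes p q :: "'i \<Rightarrow> 'e \<Rightarrow> real"
  assumes "\<And>a. smooth_on W (p a)" "\<And>a. smooth_on W (q a)"
    "\<And>a. flat k (p a) x0" "\<And>a. flat l (q a) x0" "n \<le> k + l"
  shows "flat n (\<lambda>x. \<Sum>a\<in>I. p a x * q a x) x0"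
  by (intro fl_sum sm_mult assms(1,2) fl_mult[OF assms(1,2,3,4,5)])

lemma flat_freeze:
  fixes h :: "'e \<Rightarrow> real"
  assumes "smooth_on W h"
  shows "flat 1 (\<lambda>x. h x - h x0) x0"
  by (simp add: flat_Suc)

lemma flat_comp_diff:
  fixes f :: "'e \<Rightarrow> real"
  assumes "smooth_on \<Omega> f"
  shows "flat (Suc d) (\<lambda>x. f (F x) - f x) x0"
proof -
  \<comment> \<open>Differentiation reproduces the same expression for \<open>dd b f\<close>, hence
    the induction with \<open>f\<close> varying. It also produces a term with the factor
    \<open>dd b V\<close>, flat only to order \<open>d\<close>, which caps the induction at
    \<open>Suc d\<close>.\<close>
  have "flat m (\<lambda>x. f (F x) - f x) x0" if "m \<le> Suc d" for m
    using that assms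
  proof (induction m arbitrary: f)
    case (Suc m)
    have sm: "smooth_on \<Omega> (dd a f)" for a using Suc.prems(2) by (rule smooth_on_dd)
    have "flat m (dd b (\<lambda>x. f (F x) - f x)) x0" for b
    proof (rule fl_cong)
      show "flat m (\<lambda>x. (dd b f (F x) - dd b f x)
          + (\<Sum>a\<in>Basis. (dd b V x \<bullet> a) * dd a f (F x))) x0"
      proof (rule fl_add)
        show "flat m (\<lambda>x. dd b f (F x) - dd b f x) x0"
          using Suc.IH[OF _ sm[of b]] Suc.prems by simp
        show "flat m (\<lambda>x. \<Sum>a\<in>Basis. (dd b V x \<bullet> a) * dd a f (F x)) x0"
          by (rule flat_sum_mult[OF smooth_dd_V smooth_comp[OF sm] flat_dd_V flat_0])
            (use Suc.prems in simp)
      qed (intro sm_diff sm_sum sm_mult smooth_dd_V smooth_comp sm smooth_restrict)+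
      fix x assume x: "x \<in> W"
      have fF: "f differentiable (at (F x))" and fx: "f differentiable (at x)"
        using smooth_on_differentiable[OF Suc.prems(2)] x F_maps W_sub by auto
      have Fx: "F differentiable (at x)" using smooth_on_differentiable[OF smooth_F x] .
      have "dd b (\<lambda>x. f (F x) - f x) x = dd b (\<lambda>x. f (F x)) x - dd b f x"
        by (rule dd_diff[OF _ fx])
          (rule smooth_on_differentiable[OF smooth_comp[OF Suc.prems(2)] x])
      also have "dd b (\<lambda>x. f (F x)) x = dd (b + dd b V x) f (F x)"
        by (simp add: dd_compose[OF Fx fF] dd_F[OF x])
      also have "\<dots> = dd b f (F x) + dd (dd b V x) f (F x)"
        by (rule linear_add[OF dd_linear[OF fF]])
      also have "dd (dd b V x) f (F x) = (\<Sum>a\<in>Basis. (dd b V x \<bullet> a) * dd a f (F x))"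
        using dd_euclidean[OF fF, of "dd b V x"] by simp
      finally show "dd b f (F x) - dd b f x + (\<Sum>a\<in>Basis. (dd b V x \<bullet> a) * dd a f (F x))
          = dd b (\<lambda>x. f (F x) - f x) x" by simp
    qed
    then show ?case by (simp add: flat_Suc F_x0)
  qed simp
  then show ?thesis by simp
qed

text \<open>First-order Taylor expansion along the displacement. Since order d + 2 is enough, one
  differentiation replaces a remainder estimate: the factors of \<open>dd b V\<close> combine into
  differences covered by \<open>flat_comp_diff\<close>.\<close>

lemma flat_comp_diff2:
  fixes f :: "'e \<Rightarrow> real"
  assumes f: "smooth_on \<Omega> f"
  shows "flat (d + 2) (\<lambda>x. (f (F x) - f x) - (\<Sum>a\<in>Basis. (V x \<bullet> a) * dd a f x)) x0"
proof -
  define q where "q x = (f (F x) - f x) - (\<Sum>a\<in>Basis. (V x \<bullet> a) * dd a f x)" for x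
  have sm: "smooth_on \<Omega> (dd a f)" for a using f by (rule smooth_on_dd)
  have "q x0 = 0" by (simp add: q_def V_def F_x0)
  moreover have "flat (Suc d) (dd b q) x0" for b
  proof (rule fl_cong)
    show "flat (Suc d) (\<lambda>x. (dd b f (F x) - dd b f x)
          + (\<Sum>a\<in>Basis. (dd b V x \<bullet> a) * (dd a f (F x) - dd a f x))
          - (\<Sum>a\<in>Basis. (V x \<bullet> a) * dd b (dd a f) x)) x0"
    proof (rule fl_diff[OF _ _ fl_add])
      show "flat (Suc d) (\<lambda>x. dd b f (F x) - dd b f x) x0" by (rule flat_comp_diff[OF sm])
      show "flat (Suc d) (\<lambda>x. \<Sum>a\<in>Basis. (dd b V x \<bullet> a) * (dd a f (F x) - dd a f x)) x0"
        by (rule flat_sum_mult[OF smooth_dd_V sm_diff[OF smooth_comp[OF sm] smooth_restrict[OF sm]]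
              flat_dd_V flat_comp_diff[OF sm]]) simp
      show "flat (Suc d) (\<lambda>x. \<Sum>a\<in>Basis. (V x \<bullet> a) * dd b (dd a f) x) x0"
        by (rule flat_sum_mult[OF sm_inner[OF smooth_V] smooth_restrict[OF smooth_on_dd[OF sm]]
              flat_V_inner flat_0]) simp
    qed (intro sm_add sm_diff sm_sum sm_mult sm_inner smooth_V smooth_dd_V smooth_comp sm
        smooth_restrict smooth_on_dd f)+
    fix x assume x: "x \<in> W"
    have fF: "f differentiable (at (F x))"
      using smooth_on_differentiable[OF f] x F_maps by auto
    have Fx: "F differentiable (at x)" using smooth_on_differentiable[OF smooth_F x] .
    have Vd: "(\<lambda>x. V x \<bullet> a) differentiable (at x)" for a
      by (rule smooth_on_differentiable[OF sm_inner[OF smooth_V] x])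
    have fd: "dd a f differentiable (at x)" for a
      by (rule smooth_on_differentiable[OF smooth_restrict[OF sm] x])
    have "dd b q x = dd b (\<lambda>x. f (F x) - f x) x - dd b (\<lambda>x. \<Sum>a\<in>Basis. (V x \<bullet> a) * dd a f x) x"
      unfolding q_def[abs_def]
      by (intro dd_diff smooth_on_differentiable[OF _ x] sm_add sm_diff sm_sum sm_mult sm_inner
          smooth_V smooth_comp f smooth_restrict smooth_on_dd)
    also have "dd b (\<lambda>x. f (F x) - f x) x = dd b (\<lambda>x. f (F x)) x - dd b f x"
      by (intro dd_diff smooth_on_differentiable[OF _ x] smooth_comp f smooth_restrict)
    also have "dd b (\<lambda>x. f (F x)) x = dd (b + dd b V x) f (F x)"
      by (simp add: dd_compose[OF Fx fF] dd_F[OF x])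
    also have "\<dots> = dd b f (F x) + dd (dd b V x) f (F x)"
      by (rule linear_add[OF dd_linear[OF fF]])
    also have "dd (dd b V x) f (F x) = (\<Sum>a\<in>Basis. (dd b V x \<bullet> a) * dd a f (F x))"
      using dd_euclidean[OF fF, of "dd b V x"] by simp
    also have "dd b (\<lambda>x. \<Sum>a\<in>Basis. (V x \<bullet> a) * dd a f x) x
        = (\<Sum>a\<in>Basis. dd b (\<lambda>x. (V x \<bullet> a) * dd a f x) x)"
      by (intro dd_sum smooth_on_differentiable[OF _ x] sm_mult sm_inner smooth_V smooth_restrict sm)
    also have "\<dots> = (\<Sum>a\<in>Basis. (V x \<bullet> a) * dd b (dd a f) x + (dd b V x \<bullet> a) * dd a f x)"
      by (simp add: dd_bilinear[OF bounded_bilinear_mult Vd fd]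
          dd_bounded_linear[OF bounded_linear_inner_left smooth_on_differentiable[OF smooth_V x]])
    finally show "(dd b f (F x) - dd b f x)
          + (\<Sum>a\<in>Basis. (dd b V x \<bullet> a) * (dd a f (F x) - dd a f x))
          - (\<Sum>a\<in>Basis. (V x \<bullet> a) * dd b (dd a f) x) = dd b q x"
      by (simp add: algebra_simps sum.distrib sum_subtractf)
  qed
  ultimately have "flat (Suc (Suc d)) q x0" by (simp add: flat_Suc[of "Suc d"])
  then show ?thesis by (simp add: q_def[abs_def])
qed

end

text \<open>\<open>almost_isometric_Basis\<close> is the (d+2)-isometry condition, which concerns
  derivatives of order at most d + 1 of the components. \<open>X\<close> extends the unit null
  vector \<open>n\<close> at \<open>x0\<close>.\<close>

locale lightlike_jet = near_identity \<Omega> W x0 F d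
  for \<Omega> W :: "'e::euclidean_space set" and x0 F d +
  fixes G :: "'e form_field" and X :: "'e \<Rightarrow> 'e" and n :: 'e
  assumes bil: "\<And>x. x \<in> \<Omega> \<Longrightarrow> bilinear (G x)"
    and sym: "\<And>x u w. x \<in> \<Omega> \<Longrightarrow> G x u w = G x w u"
    and smooth_G: "\<And>u w. smooth_on \<Omega> (\<lambda>x. G x u w)"
    and smooth_X: "smooth_on W X"
    and X_null: "\<And>x. x \<in> W \<Longrightarrow> X x \<in> null_space (G x)"
    and X_x0: "X x0 = n" and n_unit: "n \<bullet> n = 1" and null_x0: "null_space (G x0) = span {n}"
    and almost_isometric_Basis:
      "\<And>i j. i \<in> Basis \<Longrightarrow> j \<in> Basis \<Longrightarrow> flat (d + 2) (\<lambda>x. pullback F G x i j - G x i j) x0"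
begin

lemma x0_\<Omega>: "x0 \<in> \<Omega>"
  using x0 W_sub by auto

lemma smooth_GW: "smooth_on W (\<lambda>x. G x u w)"
  by (rule smooth_restrict[OF smooth_G])

lemma smooth_GF: "smooth_on W (\<lambda>x. G (F x) u w)"
  by (rule smooth_comp[OF smooth_G])

lemma G_left: "x \<in> \<Omega> \<Longrightarrow> G x u w = (\<Sum>a\<in>Basis. (u \<bullet> a) * G x a w)"
  using linear_euclidean[of "\<lambda>u. G x u w" u] bil by (simp add: bilinear_def)

lemma G_right: "x \<in> \<Omega> \<Longrightarrow> G x u w = (\<Sum>a\<in>Basis. (w \<bullet> a) * G x u a)"
  using linear_euclidean[of "G x u" w] bil by (simp add: bilinear_def)

lemma pullback_expansion:
  assumes "x \<in> W"
  shows "pullback F G x u w = G (F x) u w + (\<Sum>a\<in>Basis. (dd u V x \<bullet> a) * G (F x) a w)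
    + (\<Sum>a\<in>Basis. (dd w V x \<bullet> a) * G (F x) u a)
    + (\<Sum>a\<in>Basis. (dd u V x \<bullet> a) * (\<Sum>b\<in>Basis. (dd w V x \<bullet> b) * G (F x) a b))"
proof -
  have \<Omega>: "F x \<in> \<Omega>" using assms F_maps by auto
  note B = bil[OF \<Omega>]
  have "pullback F G x u w = G (F x) (u + dd u V x) (w + dd w V x)"
    by (simp add: pullback_def dd_def[symmetric] dd_F[OF assms])
  also have "\<dots> = G (F x) u w + G (F x) (dd u V x) w + G (F x) u (dd w V x)
      + G (F x) (dd u V x) (dd w V x)"
    by (simp add: bilinear_ladd[OF B] bilinear_radd[OF B])
  also have "G (F x) (dd u V x) (dd w V x)
      = (\<Sum>a\<in>Basis. (dd u V x \<bullet> a) * (\<Sum>b\<in>Basis. (dd w V x \<bullet> b) * G (F x) a b))"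
    by (rule bilinear_euclidean[OF B])
  finally show ?thesis
    by (simp add: G_left[OF \<Omega>, of "dd u V x" w] G_right[OF \<Omega>, of u "dd w V x"])
qed

lemma smooth_pullback: "smooth_on W (\<lambda>x. pullback F G x u w)"
  by (rule smooth_on_cong[OF open_W pullback_expansion[symmetric]])
    (assumption | intro sm_add sm_sum sm_mult smooth_dd_V smooth_GF)+

lemma bilinear_pullback:
  assumes "x \<in> W"
  shows "bilinear (pullback F G x)"
proof -
  have "F x \<in> \<Omega>" using assms F_maps by auto
  note B = bil[OF this]
  note l = dd_linear[OF smooth_on_differentiable[OF smooth_F assms]]
  show ?thesis
    unfolding bilinear_def pullback_def dd_def[symmetric]
    by (intro conjI allI linearI)
      (simp_all add: bilinear_ladd[OF B] bilinear_radd[OF B] bilinear_lmul[OF B]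
        bilinear_rmul[OF B] linear_add[OF l] linear_scale[OF l])
qed

lemma almost_isometric: "flat (d + 2) (\<lambda>x. pullback F G x u w - G x u w) x0"
proof (rule fl_cong)
  have sm: "smooth_on W (\<lambda>x. pullback F G x i j - G x i j)" for i j
    by (intro sm_diff smooth_pullback smooth_GW)
  have sm': "smooth_on W (\<lambda>x. \<Sum>j\<in>Basis. (w \<bullet> j) * (pullback F G x i j - G x i j))" for i
    by (intro sm_sum sm_mult smooth_on_const sm)
  show "flat (d + 2) (\<lambda>x. \<Sum>i\<in>Basis. (u \<bullet> i) *
      (\<Sum>j\<in>Basis. (w \<bullet> j) * (pullback F G x i j - G x i j))) x0"
    by (intro fl_sum sm_mult smooth_on_const sm sm'
        flat_bounded_linear[OF open_W x0 bounded_linear_mult_right sm']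
        flat_bounded_linear[OF open_W x0 bounded_linear_mult_right sm] almost_isometric_Basis)
  fix x assume x: "x \<in> W"
  then have "bilinear (G x)" using W_sub bil by auto
  from bilinear_euclidean[OF this, of u w] bilinear_euclidean[OF bilinear_pullback[OF x], of u w]
  show "(\<Sum>i\<in>Basis. (u \<bullet> i) * (\<Sum>j\<in>Basis. (w \<bullet> j) * (pullback F G x i j - G x i j)))
      = pullback F G x u w - G x u w"
    by (simp add: right_diff_distrib sum_subtractf)
qed

text \<open>The part of \<open>F\<^sup>*G - G\<close> that is linear in \<open>V\<close>, followed by its quadratic part.\<close>

definition killing :: "'e \<Rightarrow> 'e \<Rightarrow> 'e \<Rightarrow> real" where
  "killing u w x = (\<Sum>a\<in>Basis. (V x \<bullet> a) * dd a (\<lambda>y. G y u w) x)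
    + (\<Sum>a\<in>Basis. (dd u V x \<bullet> a) * G x a w) + (\<Sum>a\<in>Basis. (dd w V x \<bullet> a) * G x u a)"

definition quad :: "'e \<Rightarrow> 'e \<Rightarrow> 'e \<Rightarrow> real" where
  "quad u w x = (\<Sum>a\<in>Basis. (dd u V x \<bullet> a) * (\<Sum>b\<in>Basis. (dd w V x \<bullet> b) * G x a b))"

lemma smooth_killing: "smooth_on W (killing u w)"
  unfolding killing_def[abs_def]
  by (intro sm_add sm_sum sm_mult sm_inner smooth_V smooth_dd_V smooth_GW smooth_on_dd)

lemma smooth_quad: "smooth_on W (quad u w)"
  unfolding quad_def[abs_def]
  by (intro sm_sum sm_mult smooth_dd_V smooth_GW)

text \<open>Evaluating \<open>G\<close> at \<open>x\<close> instead of \<open>F x\<close> in the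
  terms with derivatives of \<open>V\<close> costs order d + (d + 1), enough because d \<ge> 1; the
  term without them needs the Taylor expansion. \<open>quad\<close> has to stay: only order 2d is
  known for it here.\<close>

lemma flat_killing_quad: "flat (d + 2) (\<lambda>x. killing u w x + quad u w x) x0"
proof -
  define e where "e u w x = G (F x) u w - G x u w" for u w x
  define s where "s u w x = (\<Sum>b\<in>Basis. (dd w V x \<bullet> b) * e u b x)" for u w x
  have sme: "smooth_on W (e u w)" for u w
    unfolding e_def[abs_def] by (intro sm_diff smooth_GF smooth_GW)
  have fle: "flat (Suc d) (e u w) x0" for u w
    unfolding e_def[abs_def] by (rule flat_comp_diff[OF smooth_G])
  have sms: "smooth_on W (s u w)" for u w
    unfolding s_def[abs_def] by (intro sm_sum sm_mult smooth_dd_V sme)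
  have fls: "flat (d + 2) (s u w) x0" for u w
    unfolding s_def[abs_def]
    by (rule flat_sum_mult[OF smooth_dd_V sme flat_dd_V fle]) (use d_pos in simp)
  define p where "p u w x = (\<Sum>b\<in>Basis. (dd u V x \<bullet> b) * e b w x)" for u w x
  have smp: "smooth_on W (p u w)" for u w
    unfolding p_def[abs_def] by (intro sm_sum sm_mult smooth_dd_V sme)
  have flp: "flat (d + 2) (p u w) x0" for u w
    unfolding p_def[abs_def]
    by (rule flat_sum_mult[OF smooth_dd_V sme flat_dd_V fle]) (use d_pos in simp)
  define t where "t x = (\<Sum>a\<in>Basis. (dd u V x \<bullet> a) * s a w x)" for x
  have smt: "smooth_on W t"
    unfolding t_def[abs_def] by (intro sm_sum sm_mult smooth_dd_V sms)
  have flt: "flat (d + 2) t x0"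
    unfolding t_def[abs_def]
    by (rule flat_sum_mult[OF smooth_dd_V sms flat_dd_V fls]) simp
  define r where "r x = e u w x - (\<Sum>a\<in>Basis. (V x \<bullet> a) * dd a (\<lambda>y. G y u w) x)" for x
  have smr: "smooth_on W r"
    unfolding r_def[abs_def]
    by (intro sm_diff sme sm_sum sm_mult sm_inner smooth_V smooth_on_dd smooth_GW)
  have flr: "flat (d + 2) r x0"
    unfolding r_def[abs_def] e_def by (rule flat_comp_diff2[OF smooth_G])
  have split: "pullback F G x u w - G x u w
      = (killing u w x + quad u w x) + (r x + p u w x + s u w x + t x)" if "x \<in> W" for x
    unfolding pullback_expansion[OF that] killing_def quad_def r_def p_def s_def t_def e_def
    by (simp add: algebra_simps sum.distrib sum_subtractf sum_distrib_left)
  have fl: "flat (d + 2) (\<lambda>x. (killing u w x + quad u w x) + (r x + p u w x + s u w x + t x)) x0"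
    by (rule fl_cong[OF split almost_isometric])
  have "flat (d + 2) (\<lambda>x. ((killing u w x + quad u w x) + (r x + p u w x + s u w x + t x))
      - (r x + p u w x + s u w x + t x)) x0"
    by (rule fl_diff[OF _ _ fl])
      (intro fl_add sm_add smooth_killing smooth_quad smr smp sms smt flr flp fls flt)+
  then show ?thesis by simp
qed

text \<open>The displacement lowered by the form frozen at \<open>x0\<close>: derivatives pass
  through the constant coefficients, and the component of \<open>V\<close> along \<open>n\<close> is
  lost.\<close>

definition \<omega> :: "'e \<Rightarrow> 'e \<Rightarrow> real" where "\<omega> w x = G x0 (V x) w"

lemma bounded_linear_G0: "bounded_linear (\<lambda>v. G x0 v w)"
  using bil[OF x0_\<Omega>] by (simp add: bilinear_def linear_conv_bounded_linear)

lemma smooth_\<omega>: "smooth_on W (\<omega> w)"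
  unfolding \<omega>_def[abs_def] by (rule smooth_on_bounded_linear[OF open_W bounded_linear_G0 smooth_V])

lemma dd_\<omega>: "x \<in> W \<Longrightarrow> dd u (\<omega> w) x = G x0 (dd u V x) w"
  unfolding \<omega>_def[abs_def]
  by (rule dd_bounded_linear[OF bounded_linear_G0 smooth_on_differentiable[OF smooth_V]])

text \<open>The factor \<open>G x - G x0\<close> restores the order lost by differentiating. A
  general \<open>Y\<close> is taken because the estimate is applied to \<open>V\<close> and later to
  its corrected part.\<close>

lemma flat_frozen_left:
  assumes "smooth_on W Y" "flat (Suc k) Y x0"
  shows "flat (Suc k) (\<lambda>x. \<Sum>a\<in>Basis. (dd u Y x \<bullet> a) * (G x a w - G x0 a w)) x0"
  by (rule flat_sum_mult[OF sm_inner[OF smooth_on_dd[OF assms(1)]]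
        sm_diff[OF smooth_GW smooth_on_const] fl_inner[OF smooth_on_dd[OF assms(1)] fl_dd[OF assms]]
        flat_freeze[OF smooth_GW]]) simp

lemma flat_frozen_right:
  assumes "smooth_on W Y" "flat (Suc k) Y x0"
  shows "flat (Suc k) (\<lambda>x. \<Sum>a\<in>Basis. (dd w Y x \<bullet> a) * (G x u a - G x0 u a)) x0"
  by (rule flat_sum_mult[OF sm_inner[OF smooth_on_dd[OF assms(1)]]
        sm_diff[OF smooth_GW smooth_on_const] fl_inner[OF smooth_on_dd[OF assms(1)] fl_dd[OF assms]]
        flat_freeze[OF smooth_GW]]) simp

lemma flat_\<omega>: "flat (d + 2) (\<omega> w) x0"
proof (rule flat_of_symmetrized_gradient[OF open_W x0 smooth_\<omega>])
  show "flat 2 (\<omega> w) x0" for w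
    unfolding \<omega>_def[abs_def]
    by (rule flat_mono[OF flat_bounded_linear[OF open_W x0 bounded_linear_G0 smooth_V flat_V]])
      (use d_pos in simp)
  fix u w
  define p where "p x = (\<Sum>a\<in>Basis. (V x \<bullet> a) * dd a (\<lambda>y. G y u w) x)" for x
  define l where "l x = (\<Sum>a\<in>Basis. (dd u V x \<bullet> a) * (G x a w - G x0 a w))" for x
  define r where "r x = (\<Sum>a\<in>Basis. (dd w V x \<bullet> a) * (G x u a - G x0 u a))" for x
  have smp: "smooth_on W p" and sml: "smooth_on W l" and smr: "smooth_on W r"
    unfolding p_def[abs_def] l_def[abs_def] r_def[abs_def]
    by (intro sm_sum sm_mult sm_inner sm_diff smooth_V smooth_dd_V smooth_GW smooth_on_dd smooth_on_const)+
  have flp: "flat (Suc d) p x0"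
    unfolding p_def[abs_def]
    by (rule flat_sum_mult[OF sm_inner[OF smooth_V] smooth_on_dd[OF smooth_GW] flat_V_inner flat_0]) simp
  have fll: "flat (Suc d) l x0"
    unfolding l_def[abs_def] by (rule flat_frozen_left[OF smooth_V flat_V])
  have flr: "flat (Suc d) r x0"
    unfolding r_def[abs_def] by (rule flat_frozen_right[OF smooth_V flat_V])
  \<comment> \<open>The crude order 2d suffices at this stage, where only d + 1 is asked
    for.\<close>
  have flq: "flat (Suc d) (quad u w) x0"
    unfolding quad_def[abs_def]
  proof (rule flat_sum_mult[OF smooth_dd_V _ flat_dd_V])
    show "smooth_on W (\<lambda>x. \<Sum>b\<in>Basis. (dd w V x \<bullet> b) * G x a b)" for a
      by (intro sm_sum sm_mult smooth_dd_V smooth_GW)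
    show "flat d (\<lambda>x. \<Sum>b\<in>Basis. (dd w V x \<bullet> b) * G x a b) x0" for a
      by (rule flat_sum_mult[OF smooth_dd_V smooth_GW flat_dd_V flat_0]) simp
  qed (use d_pos in simp)
  have kq: "flat (Suc d) (\<lambda>x. killing u w x + quad u w x) x0"
    by (rule flat_mono[OF flat_killing_quad]) simp
  have fl: "flat (Suc d) (\<lambda>x. (killing u w x + quad u w x) - (quad u w x + p x + l x + r x)) x0"
    by (rule fl_diff[OF _ _ kq])
      (intro fl_add sm_add smooth_killing smooth_quad smp sml smr flq flp fll flr)+
  show "flat (Suc d) (\<lambda>x. dd u (\<omega> w) x + dd w (\<omega> u) x) x0"
  proof (rule fl_cong[OF _ fl])
    fix x assume x: "x \<in> W"
    show "killing u w x + quad u w x - (quad u w x + p x + l x + r x)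
        = dd u (\<omega> w) x + dd w (\<omega> u) x"
      using dd_\<omega>[OF x, of u w] dd_\<omega>[OF x, of w u] sym[OF x0_\<Omega>, of "dd w V x" u]
        G_left[OF x0_\<Omega>, of "dd u V x" w] G_right[OF x0_\<Omega>, of u "dd w V x"]
      by (simp add: killing_def p_def l_def r_def algebra_simps sum_subtractf)
  qed
qed

text \<open>Once \<open>\<omega>\<close> is known to order d + 2, one derivative factor may be
  absorbed into \<open>dd u (\<omega> b)\<close>, which has order d + 1 instead of d. The other
  factor brings the total to 2d + 1, and the freezing error has the same order.\<close>

lemma flat_quad: "flat (d + 2) (quad u w) x0"
proof -
  have fl1: "flat (d + 2) (\<lambda>x. \<Sum>b\<in>Basis. (dd w V x \<bullet> b) *
      (\<Sum>a\<in>Basis. (dd u V x \<bullet> a) * (G x a b - G x0 a b))) x0"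
  proof (rule flat_sum_mult[OF smooth_dd_V _ flat_dd_V flat_frozen_left[OF smooth_V flat_V]])
    show "smooth_on W (\<lambda>x. \<Sum>a\<in>Basis. (dd u V x \<bullet> a) * (G x a b - G x0 a b))" for b
      by (intro sm_sum sm_mult sm_diff smooth_dd_V smooth_GW smooth_on_const)
  qed (use d_pos in simp)
  have fl2: "flat (d + 2) (\<lambda>x. \<Sum>b\<in>Basis. (dd w V x \<bullet> b) * dd u (\<omega> b) x) x0"
  proof (rule flat_sum_mult[OF smooth_dd_V smooth_on_dd[OF smooth_\<omega>] flat_dd_V])
    show "flat (Suc d) (dd u (\<omega> b)) x0" for b
      using fl_dd[OF smooth_\<omega>] flat_\<omega> by simp
  qed (use d_pos in simp)
  show ?thesis
  proof (rule fl_cong)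
    show "flat (d + 2) (\<lambda>x. (\<Sum>b\<in>Basis. (dd w V x \<bullet> b) *
        (\<Sum>a\<in>Basis. (dd u V x \<bullet> a) * (G x a b - G x0 a b)))
        + (\<Sum>b\<in>Basis. (dd w V x \<bullet> b) * dd u (\<omega> b) x)) x0"
      by (intro fl_add fl1 fl2 sm_sum sm_mult sm_diff smooth_dd_V smooth_GW smooth_on_const
          smooth_on_dd smooth_\<omega>)
    fix x assume x: "x \<in> W"
    have "(\<Sum>b\<in>Basis. (dd w V x \<bullet> b) * dd u (\<omega> b) x)
        = (\<Sum>b\<in>Basis. (dd w V x \<bullet> b) * (\<Sum>a\<in>Basis. (dd u V x \<bullet> a) * G x0 a b))"
      by (simp add: dd_\<omega>[OF x] flip: G_left[OF x0_\<Omega>])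
    then have "(\<Sum>b\<in>Basis. (dd w V x \<bullet> b) *
        (\<Sum>a\<in>Basis. (dd u V x \<bullet> a) * (G x a b - G x0 a b)))
        + (\<Sum>b\<in>Basis. (dd w V x \<bullet> b) * dd u (\<omega> b) x)
        = (\<Sum>b\<in>Basis. \<Sum>a\<in>Basis. (dd u V x \<bullet> a) * ((dd w V x \<bullet> b) * G x a b))"
      by (simp add: sum_distrib_left algebra_simps sum_subtractf)
    also have "\<dots> = quad u w x"
      unfolding quad_def sum_distrib_left by (rule sum.swap)
    finally show "(\<Sum>b\<in>Basis. (dd w V x \<bullet> b) *
        (\<Sum>a\<in>Basis. (dd u V x \<bullet> a) * (G x a b - G x0 a b)))
        + (\<Sum>b\<in>Basis. (dd w V x \<bullet> b) * dd u (\<omega> b) x) = quad u w x" .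
  qed
qed

lemma flat_killing: "flat (d + 2) (killing u w) x0"
proof -
  have "flat (d + 2) (\<lambda>x. (killing u w x + quad u w x) - quad u w x) x0"
    by (intro fl_diff flat_killing_quad flat_quad sm_add smooth_killing smooth_quad)
  then show ?thesis by simp
qed

section \<open>Splitting the displacement along the null field\<close>

definition \<nu> :: "'e \<Rightarrow> real" where "\<nu> x = V x \<bullet> n"

definition Y :: "'e \<Rightarrow> 'e" where "Y x = V x - \<nu> x *\<^sub>R X x"

lemma smooth_\<nu>: "smooth_on W \<nu>"
  unfolding \<nu>_def[abs_def] by (rule sm_inner[OF smooth_V])

lemma flat_\<nu>: "flat (Suc d) \<nu> x0"
  unfolding \<nu>_def[abs_def] by (rule flat_V_inner)

lemma smooth_Y: "smooth_on W Y"
  unfolding Y_def[abs_def] by (intro sm_diff sm_scaleR smooth_V smooth_\<nu> smooth_X)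

text \<open>\<open>\<omega>\<close> determines \<open>V\<close> modulo \<open>n\<close>: as
  \<open>n\<close> is a unit vector, \<open>V - \<nu> n\<close> has no component along
  \<open>n\<close>, and inverting \<open>completed\<close> makes it a fixed linear image of
  \<open>\<omega>\<close>. Passing from \<open>n\<close> to \<open>X\<close> costs
  \<open>\<nu> (X - n)\<close>, of order (d + 1) + 1.\<close>

lemma flat_Y: "flat (d + 2) Y x0"
proof -
  note B = bil[OF x0_\<Omega>]
  obtain \<Lambda> where \<Lambda>: "linear \<Lambda>" "\<Lambda> \<circ> completed (G x0) n = id"
    using linear_injective_left_inverse[OF linear_completed[OF B]
        inj_completed[OF B sym[OF x0_\<Omega>] n_unit null_x0]] by blast
  have nn: "G x0 n w = 0" for w
    using span_base[of n "{n}"] null_x0 by (auto simp: null_space_def)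
  have "completed (G x0) n (V x - \<nu> x *\<^sub>R n) = (\<Sum>i\<in>Basis. \<omega> i x *\<^sub>R i)" for x
    by (simp add: completed_def bilinear_lsub[OF B] bilinear_lmul[OF B] nn \<omega>_def
        inner_diff_right n_unit \<nu>_def inner_commute)
  then have eq: "\<Lambda> (\<Sum>i\<in>Basis. \<omega> i x *\<^sub>R i) = V x - \<nu> x *\<^sub>R n" for x
    using \<Lambda>(2) by (metis comp_apply id_apply)
  have sm: "smooth_on W (\<lambda>x. \<Sum>i\<in>Basis. \<omega> i x *\<^sub>R (i::'e))"
    by (intro sm_sum sm_scaleR smooth_\<omega> smooth_on_const)
  have "flat (d + 2) (\<lambda>x. \<Sum>i\<in>Basis. \<omega> i x *\<^sub>R (i::'e)) x0"
    by (intro fl_sum sm_scaleR smooth_\<omega> smooth_on_const fl_scaleR[OF smooth_\<omega> smooth_on_const flat_\<omega> flat_0]) simp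
  from flat_bounded_linear[OF open_W x0 _ sm this, of \<Lambda>] \<Lambda>(1)
  have fl1: "flat (d + 2) (\<lambda>x. V x - \<nu> x *\<^sub>R n) x0"
    by (simp add: eq linear_conv_bounded_linear)
  have fl2: "flat (d + 2) (\<lambda>x. \<nu> x *\<^sub>R (X x - n)) x0"
    by (rule fl_scaleR[OF smooth_\<nu> sm_diff[OF smooth_X smooth_on_const] flat_\<nu>, where l = 1])
      (simp_all add: flat_Suc X_x0)
  have "flat (d + 2) (\<lambda>x. (V x - \<nu> x *\<^sub>R n) - \<nu> x *\<^sub>R (X x - n)) x0"
    by (intro fl_diff fl1 fl2 sm_diff sm_scaleR smooth_V smooth_\<nu> smooth_X smooth_on_const)
  moreover have "(V x - \<nu> x *\<^sub>R n) - \<nu> x *\<^sub>R (X x - n) = Y x" for x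
    by (simp add: Y_def scaleR_diff_right)
  ultimately show ?thesis by simp
qed

lemma lie_deriv_expansion:
  assumes "x \<in> W" "Z differentiable (at x)"
  shows "lie_deriv Z G x u w = (\<Sum>a\<in>Basis. (Z x \<bullet> a) * dd a (\<lambda>y. G y u w) x)
    + (\<Sum>a\<in>Basis. (dd u Z x \<bullet> a) * G x a w) + (\<Sum>a\<in>Basis. (dd w Z x \<bullet> a) * G x u a)"
proof -
  have "x \<in> \<Omega>" using assms W_sub by auto
  then show ?thesis
    using dd_euclidean[OF smooth_on_differentiable[OF smooth_GW assms(1)], of "Z x" u w]
      G_left[of x "dd u Z x" w] G_right[of x u "dd w Z x"]
    by (simp add: lie_deriv_def flip: dd_def)
qed

text \<open>The Lie derivative is linear over functions along \<open>X\<close>: the terms with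
  derivatives of \<open>\<nu>\<close> carry a factor \<open>G x (X x) v\<close>, which is
  zero.\<close>

lemma killing_split:
  assumes x: "x \<in> W"
  shows "killing u w x = \<nu> x * lie_deriv X G x u w + lie_deriv Y G x u w"
proof -
  have Xd: "X differentiable (at x)" and \<nu>d: "\<nu> differentiable (at x)"
    and Vd: "V differentiable (at x)" and Yd: "Y differentiable (at x)"
    using smooth_on_differentiable smooth_X smooth_\<nu> smooth_V smooth_Y x by blast+
  have \<Omega>: "x \<in> \<Omega>" using x W_sub by auto
  have "dd v Y x = dd v V x - dd v (\<lambda>x. \<nu> x *\<^sub>R X x) x" for v
    unfolding Y_def[abs_def]
    by (intro dd_diff Vd smooth_on_differentiable[OF sm_scaleR[OF smooth_\<nu> smooth_X] x])
  then have ddV: "dd v V x = \<nu> x *\<^sub>R dd v X x + dd v \<nu> x *\<^sub>R X x + dd v Y x" for v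
    by (simp add: dd_bilinear[OF bounded_bilinear_scaleR \<nu>d Xd])
  have Vx: "V x = \<nu> x *\<^sub>R X x + Y x" by (simp add: Y_def)
  have X0: "G x (X x) v = 0" "G x v (X x) = 0" for v
    using X_null[OF x] sym[OF \<Omega>, of v] by (auto simp: null_space_def)
  have "killing u w x = lie_deriv V G x u w"
    unfolding killing_def lie_deriv_expansion[OF x Vd] ..
  also have "\<dots> = dd (V x) (\<lambda>y. G y u w) x + G x (dd u V x) w + G x u (dd w V x)"
    by (simp add: lie_deriv_def dd_def)
  also have "\<dots> = \<nu> x * (dd (X x) (\<lambda>y. G y u w) x + G x (dd u X x) w + G x u (dd w X x))
      + (dd (Y x) (\<lambda>y. G y u w) x + G x (dd u Y x) w + G x u (dd w Y x))"
    using linear_add[OF dd_linear[OF smooth_on_differentiable[OF smooth_GW x]]]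
      linear_scale[OF dd_linear[OF smooth_on_differentiable[OF smooth_GW x]]]
    by (simp add: Vx ddV bilinear_ladd[OF bil[OF \<Omega>]] bilinear_radd[OF bil[OF \<Omega>]]
        bilinear_lmul[OF bil[OF \<Omega>]] bilinear_rmul[OF bil[OF \<Omega>]] X0 algebra_simps)
  finally show ?thesis by (simp add: lie_deriv_def dd_def)
qed

definition L :: "'e \<Rightarrow> 'e \<Rightarrow> real" where "L u w = lie_deriv X G x0 u w"

lemma bilinear_L: "bilinear L"
proof -
  note B = bil[OF x0_\<Omega>]
  have Xd: "X differentiable (at x0)" by (rule smooth_on_differentiable[OF smooth_X x0])
  note l = dd_linear[OF Xd]
  have cong: "dd z (\<lambda>y. G y u w) x0 = dd z h x0" if "\<And>y. y \<in> W \<Longrightarrow> G y u w = h y" for z u w h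
    by (rule dd_cong[OF open_W x0 that])
  have Gd: "(\<lambda>y. G y u w) differentiable (at x0)" for u w
    by (rule smooth_on_differentiable[OF smooth_GW x0])
  have a1: "dd z (\<lambda>y. G y (u + v) w) x0 = dd z (\<lambda>y. G y u w) x0 + dd z (\<lambda>y. G y v w) x0" for z u v w
  proof -
    have "dd z (\<lambda>y. G y (u + v) w) x0 = dd z (\<lambda>y. G y u w + G y v w) x0"
      by (rule cong) (simp add: bilinear_ladd[OF bil] subsetD[OF W_sub])
    then show ?thesis by (simp add: dd_add[OF Gd Gd])
  qed
  have a2: "dd z (\<lambda>y. G y u (v + w)) x0 = dd z (\<lambda>y. G y u v) x0 + dd z (\<lambda>y. G y u w) x0" for z u v w
  proof -
    have "dd z (\<lambda>y. G y u (v + w)) x0 = dd z (\<lambda>y. G y u v + G y u w) x0"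
      by (rule cong) (simp add: bilinear_radd[OF bil] subsetD[OF W_sub])
    then show ?thesis by (simp add: dd_add[OF Gd Gd])
  qed
  have m1: "dd z (\<lambda>y. G y (c *\<^sub>R u) w) x0 = c * dd z (\<lambda>y. G y u w) x0" for z u w c
  proof -
    have "dd z (\<lambda>y. G y (c *\<^sub>R u) w) x0 = dd z (\<lambda>y. c * G y u w) x0"
      by (rule cong) (simp add: bilinear_lmul[OF bil] subsetD[OF W_sub])
    then show ?thesis by (simp add: dd_bounded_linear[OF bounded_linear_mult_right Gd])
  qed
  have m2: "dd z (\<lambda>y. G y u (c *\<^sub>R w)) x0 = c * dd z (\<lambda>y. G y u w) x0" for z u w c
  proof -
    have "dd z (\<lambda>y. G y u (c *\<^sub>R w)) x0 = dd z (\<lambda>y. c * G y u w) x0"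
      by (rule cong) (simp add: bilinear_rmul[OF bil] subsetD[OF W_sub])
    then show ?thesis by (simp add: dd_bounded_linear[OF bounded_linear_mult_right Gd])
  qed
  have L: "L u w = dd (X x0) (\<lambda>y. G y u w) x0 + G x0 (dd u X x0) w + G x0 u (dd w X x0)" for u w
    by (simp add: L_def lie_deriv_def dd_def)
  show ?thesis
    unfolding bilinear_def
    by (intro conjI allI linearI)
      (simp_all add: L a1 a2 m1 m2 bilinear_ladd[OF B] bilinear_radd[OF B] bilinear_lmul[OF B]
        bilinear_rmul[OF B] linear_add[OF l] linear_scale[OF l] algebra_simps)
qed

lemma L_sym: "L u w = L w u"
proof -
  have "dd z (\<lambda>y. G y u w) x0 = dd z (\<lambda>y. G y w u) x0" for z
    by (rule dd_cong[OF open_W x0]) (use sym W_sub in auto)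
  then show ?thesis
    using sym[OF x0_\<Omega>] by (simp add: L_def lie_deriv_def flip: dd_def)
qed

text \<open>With \<open>Y\<close> of order d + 2, every coefficient of the Killing equation can be
  frozen at \<open>x0\<close> without loss, which produces the constant-coefficient equation of
  \<open>flat_of_killing_defect\<close>.\<close>

lemma flat_V_improved:
  assumes ker: "\<And>u. (\<And>w. L u w = 0) \<Longrightarrow> u \<in> span {n}" and dim: "DIM('e) \<ge> 4"
  shows "flat (d + 2) V x0"
proof -
  define \<eta> where "\<eta> w x = G x0 (Y x) w" for w x
  have sm\<eta>: "smooth_on W (\<eta> w)" for w
    unfolding \<eta>_def[abs_def] by (rule smooth_on_bounded_linear[OF open_W bounded_linear_G0 smooth_Y])
  have dd\<eta>: "dd u (\<eta> w) x = G x0 (dd u Y x) w" if "x \<in> W" for u w x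
    unfolding \<eta>_def[abs_def]
    by (rule dd_bounded_linear[OF bounded_linear_G0 smooth_on_differentiable[OF smooth_Y that]])
  have flY: "flat (Suc (Suc d)) Y x0" using flat_Y by simp
  have "flat (d + 2) \<nu> x0"
  proof (rule flat_of_killing_defect[OF open_W x0 sm\<eta> smooth_\<nu> _ _ bilinear_L L_sym ker dim])
    show "flat 2 \<nu> x0" by (rule flat_mono[OF flat_\<nu>]) (use d_pos in simp)
    fix u w
    define p where "p x = (\<Sum>a\<in>Basis. (Y x \<bullet> a) * dd a (\<lambda>y. G y u w) x)" for x
    define l where "l x = (\<Sum>a\<in>Basis. (dd u Y x \<bullet> a) * (G x a w - G x0 a w))" for x
    define r where "r x = (\<Sum>a\<in>Basis. (dd w Y x \<bullet> a) * (G x u a - G x0 u a))" for x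
    \<comment> \<open>The Lie derivative along \<open>X\<close> written out in components, so that
      it is visibly smooth on \<open>W\<close>.\<close>
    define \<Lambda> where "\<Lambda> x = (\<Sum>a\<in>Basis. (X x \<bullet> a) * dd a (\<lambda>y. G y u w) x)
      + (\<Sum>a\<in>Basis. (dd u X x \<bullet> a) * G x a w) + (\<Sum>a\<in>Basis. (dd w X x \<bullet> a) * G x u a)" for x
    have \<Lambda>: "\<Lambda> x = lie_deriv X G x u w" if "x \<in> W" for x
      unfolding \<Lambda>_def lie_deriv_expansion[OF that smooth_on_differentiable[OF smooth_X that]] ..
    have smp: "smooth_on W p" and sml: "smooth_on W l" and smr: "smooth_on W r" and sm\<Lambda>: "smooth_on W \<Lambda>"
      unfolding p_def[abs_def] l_def[abs_def] r_def[abs_def] \<Lambda>_def[abs_def]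
      by (intro sm_add sm_sum sm_mult sm_inner sm_diff smooth_Y smooth_X smooth_GW smooth_on_dd
          smooth_on_const)+
    have flp: "flat (d + 2) p x0"
      unfolding p_def[abs_def]
      by (rule flat_sum_mult[OF sm_inner[OF smooth_Y] smooth_on_dd[OF smooth_GW]
            fl_inner[OF smooth_Y flY] flat_0]) simp
    have fll: "flat (d + 2) l x0"
      unfolding l_def[abs_def] using flat_frozen_left[OF smooth_Y flY] by simp
    have flr: "flat (d + 2) r x0"
      unfolding r_def[abs_def] using flat_frozen_right[OF smooth_Y flY] by simp
    have smq: "smooth_on W (\<lambda>x. \<nu> x * (\<Lambda> x - \<Lambda> x0))"
      by (intro sm_mult sm_diff smooth_\<nu> sm\<Lambda> smooth_on_const)
    \<comment> \<open>Freezing \<open>L_X G\<close> is affordable: the order d + 1 of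
      \<open>\<nu>\<close> plus the order 1 of the difference.\<close>
    have flq: "flat (d + 2) (\<lambda>x. \<nu> x * (\<Lambda> x - \<Lambda> x0)) x0"
      by (rule fl_mult[OF smooth_\<nu> sm_diff[OF sm\<Lambda> smooth_on_const] flat_\<nu> flat_freeze[OF sm\<Lambda>]]) simp
    have fl: "flat (d + 2) (\<lambda>x. killing u w x - (p x + l x + r x + \<nu> x * (\<Lambda> x - \<Lambda> x0))) x0"
      by (intro fl_diff fl_add sm_add smooth_killing smp sml smr smq flat_killing flp fll flr flq)
    show "flat (d + 2) (\<lambda>x. dd u (\<eta> w) x + dd w (\<eta> u) x + \<nu> x * L u w) x0"
    proof (rule fl_cong[OF _ fl])
      fix x assume x: "x \<in> W"
      show "killing u w x - (p x + l x + r x + \<nu> x * (\<Lambda> x - \<Lambda> x0))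
          = dd u (\<eta> w) x + dd w (\<eta> u) x + \<nu> x * L u w"
        using dd\<eta>[OF x, of u w] dd\<eta>[OF x, of w u] sym[OF x0_\<Omega>, of "dd w Y x" u]
          G_left[OF x0_\<Omega>, of "dd u Y x" w] G_right[OF x0_\<Omega>, of u "dd w Y x"]
        unfolding killing_split[OF x] L_def \<Lambda>[OF x0, symmetric] \<Lambda>[OF x, symmetric]
          lie_deriv_expansion[OF x smooth_on_differentiable[OF smooth_Y x]]
        by (simp add: p_def l_def r_def algebra_simps sum_subtractf)
    qed
  qed
  then have "flat (d + 2) (\<lambda>x. \<nu> x *\<^sub>R X x) x0"
    by (rule fl_scaleR[OF smooth_\<nu> smooth_X _ flat_0]) simp
  then have "flat (d + 2) (\<lambda>x. \<nu> x *\<^sub>R X x + Y x) x0"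
    by (intro fl_add flat_Y smooth_Y sm_scaleR smooth_\<nu> smooth_X)
  then show ?thesis by (simp add: Y_def)
qed

end

section \<open>Subrigidity\<close>

lemma same_derivs_upto_iff_flat:
  assumes "open W" "x \<in> W" "smooth_on W F"
  shows "same_derivs_upto k F (\<lambda>x. x) x \<longleftrightarrow> flat (Suc k) (\<lambda>x. F x - x) x"
  unfolding same_derivs_upto_def flat_def
  by (simp add: iter_deriv_diff[OF assms(1,3) smooth_on_ident assms(2)] less_Suc_eq_le)

text \<open>The coordinate expression describes \<open>\<Psi>\<close> only at chart points whose
  image stays in the chart; continuity of \<open>\<Psi>\<close> makes this set open.\<close>

lemma local_rep_domain:
  assumes "smooth_manifold A" "local_diffeo A U \<Psi>" "c \<in> A" "v \<in> U" "v \<in> cdom c" "\<Psi> v = v"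
  defines "W \<equiv> coord c ` {p \<in> U. p \<in> cdom c \<and> \<Psi> p \<in> cdom c}"
  shows "open W" "coord c v \<in> W" "W \<subseteq> coord c ` cdom c"
    "local_rep c c \<Psi> ` W \<subseteq> coord c ` cdom c" "smooth_on W (local_rep c c \<Psi>)"
    "local_rep c c \<Psi> (coord c v) = coord c v"
proof -
  have ch: "is_chart c" using assms by (simp add: smooth_manifold_def)
  then have hom: "homeomorphism (cdom c) (coord c ` cdom c) (coord c) (param c)"
    and op: "open (cdom c)" "open (coord c ` cdom c)"
    by (auto simp: is_chart_def)
  have inv: "param c (coord c p) = p" if "p \<in> cdom c" for p
    using hom that by (simp add: homeomorphism_def)
  have U: "open U" "continuous_on U \<Psi>"
    using assms(2) by (auto simp: local_diffeo_def smooth_map_def)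
  have eq: "{p \<in> U. p \<in> cdom c \<and> \<Psi> p \<in> cdom c} = cdom c \<inter> (U \<inter> \<Psi> -` cdom c)" by auto
  have D: "open {p \<in> U. p \<in> cdom c \<and> \<Psi> p \<in> cdom c}"
    unfolding eq by (intro open_Int op continuous_open_preimage U)
  have "openin (top_of_set (coord c ` cdom c)) W"
    unfolding W_def
    by (rule homeomorphism_imp_open_map[OF hom]) (auto intro!: openin_open_eq[THEN iffD2] op D)
  then show "open W" using op(2) openin_open_eq by blast
  show "coord c v \<in> W" "W \<subseteq> coord c ` cdom c" using assms by (auto simp: W_def)
  show "local_rep c c \<Psi> ` W \<subseteq> coord c ` cdom c"
    by (auto simp: W_def local_rep_def inv)
  show "smooth_on W (local_rep c c \<Psi>)"
    using assms(2,3) by (auto simp: local_diffeo_def smooth_map_def W_def)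
  show "local_rep c c \<Psi> (coord c v) = coord c v"
    using assms by (simp add: local_rep_def inv)
qed

lemma smooth_on_components:
  fixes G :: "'e::euclidean_space form_field"
  assumes "open \<Omega>" "\<And>x. x \<in> \<Omega> \<Longrightarrow> bilinear (G x)"
    "\<And>i j. i \<in> Basis \<Longrightarrow> j \<in> Basis \<Longrightarrow> smooth_on \<Omega> (\<lambda>x. G x i j)"
  shows "smooth_on \<Omega> (\<lambda>x. G x u w)"
  by (rule smooth_on_cong[OF assms(1) bilinear_euclidean[OF assms(2), symmetric]])
    (assumption | intro smooth_on_sum smooth_on_mult smooth_on_const assms(1,3))+

lemma subrigid_generic_lightlike:
  fixes A :: "('a::{t2_space, second_countable_topology}, 'e::euclidean_space) chart set"
  assumes mf: "smooth_manifold A" and gen: "generic_lightlike A g"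
    and dim: "DIM('e) \<ge> 4" and d: "d \<ge> 1"
  shows "subrigid A g (d + 2) d"
  unfolding subrigid_def
proof (intro allI impI)
  fix v U \<Psi> assume "d_isometry_at A g (d + 2) U \<Psi> v \<and> trivial_jet A d \<Psi> v"
  then have iso: "d_isometry_at A g (d + 2) U \<Psi> v" and jet: "trivial_jet A d \<Psi> v" by auto
  have diffeo: "local_diffeo A U \<Psi>" and v: "v \<in> U" "\<Psi> v = v"
    using iso by (auto simp: d_isometry_at_def)
  have "same_derivs_upto (d + 1) (local_rep c c \<Psi>) (\<lambda>x. x) (coord c v)"
    if c: "c \<in> A" "v \<in> cdom c" for c
  proof -
    define \<Omega> where "\<Omega> = coord c ` cdom c"
    define W where "W = coord c ` {p \<in> U. p \<in> cdom c \<and> \<Psi> p \<in> cdom c}"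
    define F where "F = local_rep c c \<Psi>"
    define G where "G = g c"
    define x0 where "x0 = coord c v"
    note dom = local_rep_domain[OF mf diffeo c(1) v(1) c(2) v(2),
        folded W_def \<Omega>_def F_def x0_def]
    have light: "lightlike_metric A g" using gen by (simp add: generic_lightlike_def)
    then have bil: "bilinear (G x)" and sym: "G x u w = G x w u" if "x \<in> \<Omega>" for x u w
      using c that by (auto simp: lightlike_metric_def symmetric_2_tensor_def G_def \<Omega>_def)
    have null: "dim (null_space (G x)) = 1" if "x \<in> \<Omega>" for x
      using light c that by (auto simp: lightlike_metric_def G_def \<Omega>_def)
    have op: "open \<Omega>" using mf c by (auto simp: smooth_manifold_def is_chart_def \<Omega>_def)
    have "smooth_on \<Omega> (\<lambda>x. G x i j)" if "i \<in> Basis" "j \<in> Basis" for i j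
      using light c that by (auto simp: lightlike_metric_def symmetric_2_tensor_def G_def \<Omega>_def)
    then have smG: "smooth_on \<Omega> (\<lambda>x. G x u w)" for u w
      using smooth_on_components[of \<Omega> G] op bil by blast
    have x0: "x0 \<in> \<Omega>" using dom by auto
    obtain W' X n where W': "open W'" "x0 \<in> W'" "W' \<subseteq> \<Omega>" and X: "smooth_on W' X"
      and n: "n \<bullet> n = 1" "null_space (G x0) = span {n}" "X x0 = n"
      and Xn: "\<And>x. x \<in> W' \<Longrightarrow> X x \<bullet> n = 1" "\<And>x. x \<in> W' \<Longrightarrow> X x \<in> null_space (G x)"
      using smooth_null_field[OF op x0 bil sym smG null] by metis
    interpret lightlike_jet \<Omega> "W \<inter> W'" x0 F d G X n
    proof
      show "open (W \<inter> W')" using dom W' by blast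
      show "smooth_on (W \<inter> W') F" "smooth_on (W \<inter> W') X"
        using dom(5) X smooth_on_subset by blast+
      show "flat (Suc d) (\<lambda>x. F x - x) x0"
      proof -
        have "same_derivs_upto d F (\<lambda>x. x) x0"
          using jet c unfolding trivial_jet_def F_def x0_def by blast
        then show ?thesis using same_derivs_upto_iff_flat[OF dom(1,2,5)] by blast
      qed
      show "flat (d + 2) (\<lambda>x. pullback F G x i j - G x i j) x0" if "i \<in> Basis" "j \<in> Basis" for i j
        using iso c that by (auto simp: d_isometry_at_def flat_def F_def G_def x0_def)
    qed (use dom W' n Xn bil sym smG d in auto)
    have "flat (d + 2) V x0"
    proof (rule flat_V_improved[OF _ dim])
      fix u assume u: "\<And>w. L u w = 0"
      \<comment> \<open>The normalization \<open>X x \<bullet> n = 1\<close> excludes zeros of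
        \<open>X\<close> on all of \<open>W'\<close>, so that genericity applies to this
        field.\<close>
      have "\<forall>x\<in>W'. X x \<noteq> 0 \<and> X x \<in> null_space (g c x)"
        using Xn by (force simp: G_def)
      then have "open W' \<and> W' \<subseteq> coord c ` cdom c \<and> smooth_on W' X \<and>
          (\<forall>x\<in>W'. X x \<noteq> 0 \<and> X x \<in> null_space (g c x))"
        using W' X by (simp add: \<Omega>_def)
      with gen c(1) have "\<forall>x\<in>W'. \<forall>u. (\<forall>w. lie_deriv X (g c) x u w = 0) \<longrightarrow> u \<in> null_space (g c x)"
        unfolding generic_lightlike_def by meson
      moreover have "lie_deriv X (g c) x0 u w = 0" for w
        using u[of w] by (simp only: L_def flip: G_def)
      ultimately have "u \<in> null_space (g c x0)" using W'(2) by blast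
      then show "u \<in> span {n}" using n by (simp add: G_def)
    qed
    then have "flat (Suc (d + 1)) (\<lambda>x. F x - x) x0" by (simp add: V_def[abs_def])
    then have "same_derivs_upto (d + 1) F (\<lambda>x. x) x0"
      using same_derivs_upto_iff_flat[OF dom(1,2,5)] by blast
    then show ?thesis by (simp only: F_def x0_def)
  qed
  with v show "trivial_jet A (d + 1) \<Psi> v" by (simp add: trivial_jet_def)
qed

text \<open>The defect vanishes identically near the point, hence the arbitrary order
  \<open>m\<close>, which the induction on jets relies on.\<close>

lemma isometry_d_isometry_at:
  assumes mf: "smooth_manifold A" and iso: "isometry A g U \<Psi>" and v: "v \<in> U" "\<Psi> v = v"
  shows "d_isometry_at A g m U \<Psi> v"
proof -
  have diffeo: "local_diffeo A U \<Psi>" using iso by (simp add: isometry_def)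
  have "iter_deriv bs (\<lambda>x. pullback (local_rep c c \<Psi>) (g c) x i j - g c x i j) (coord c v) = 0"
    if c: "c \<in> A" "v \<in> cdom c" for c i j bs
  proof -
    note dom = local_rep_domain[OF mf diffeo c(1) v(1) c(2) v(2)]
    have "iter_deriv bs (\<lambda>x. pullback (local_rep c c \<Psi>) (g c) x i j - g c x i j) (coord c v)
        = iter_deriv bs (\<lambda>x. 0) (coord c v)"
      by (rule iter_deriv_cong[OF dom(1,2)]) (use iso c in \<open>auto simp: isometry_def\<close>)
    then show ?thesis by (simp add: iter_deriv_zero)
  qed
  with diffeo v show ?thesis by (simp add: d_isometry_at_def)
qed

theorem theorem2p2:
  fixes A :: "('a::{t2_space, second_countable_topology}, 'e::euclidean_space) chart set"
    and g :: "('a, 'e) tensor2"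
  assumes "smooth_manifold A"
    and "generic_lightlike A g"
    and "DIM('e) \<ge> 4"
  shows "(\<forall>d\<ge>1. subrigid A g (d + 2) d) \<and>
    (\<forall>U \<Psi> v. isometry A g U \<Psi> \<and> v \<in> U \<and> trivial_jet A 1 \<Psi> v \<longrightarrow> (\<forall>k. trivial_jet A k \<Psi> v))"
proof (intro conjI allI impI)
  show sub: "subrigid A g (d + 2) d" if "d \<ge> 1" for d
    using subrigid_generic_lightlike[OF assms that] .
  fix U \<Psi> v k assume *: "isometry A g U \<Psi> \<and> v \<in> U \<and> trivial_jet A 1 \<Psi> v"
  then have "\<Psi> v = v" by (simp add: trivial_jet_def)
  with * have "d_isometry_at A g m U \<Psi> v" for m
    using isometry_d_isometry_at[OF assms(1)] by blast
  with sub have step: "trivial_jet A j \<Psi> v \<Longrightarrow> j \<ge> 1 \<Longrightarrow> trivial_jet A (j + 1) \<Psi> v" for j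
    unfolding subrigid_def by blast
  \<comment> \<open>Indexed by \<open>Suc j\<close> because subrigidity starts at order 1. Step
    \<open>j\<close> uses that the isometry is isometric up to order \<open>j + 2\<close>.\<close>
  have "trivial_jet A (Suc j) \<Psi> v" for j
    using * step by (induction j) auto
  then have "trivial_jet A (Suc k) \<Psi> v" .
  then show "trivial_jet A k \<Psi> v"
    by (auto simp: trivial_jet_def same_derivs_upto_def)
qed

end
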